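(* Let $H$ be a finite index subgroup of $\mathrm{SL}(2,\mathbb Z)$, let $\Gamma=\mathrm{PSL}(2,\mathbb Z)$, and let $\bar H$ be the image of $H$ in $\Gamma$. Then for each cusp $\kappa$ of $H$ and for (Lebesgue) almost every real $x$, the regular continued fraction approximants $p_n/q_n$ of $x$ satisfy $$\lim_{N\to\infty}\frac{\#\{0\le n\le N \mid p_n/q_n\in\kappa\}}{N}=\frac{w(\kappa)}{[\Gamma:\bar H]}.$$
   Context: $\Gamma=\mathrm{SL}(2,\mathbb Z)/\{\pm I\}$ acts on $\mathbb Q\cup\{\infty\}$ by Möbius transformations. A cusp $\kappa$ of $H$ is an $\bar H$-orbit in $\mathbb Q\cup\{\infty\}$. The width $w(\kappa)$ of a cusp $\kappa$ is the index of the $\bar H$-stabilizer of a point of $\kappa$ inside the $\Gamma$-stabilizer of that point (this does not depend on the point chosen in $\kappa$). Regular continued fractions: the Gauss map on $[0,1)$ is $T(x)=1/x-\lfloor 1/x\rfloor$ for $x\ne0$, $T(0)=0$. For real $x$, let $d_0\in\mathbb Z$ be such that $x-d_0\in[0,1)$, and for $n\ge1$ let $d_n=\lfloor 1/T^{n-1}(x-d_0)\rfloor$ (for irrational $x$ all $d_n$ are defined). The $n$-th approximant of $x$ is $p_n/q_n=d_0+\cfrac{1}{d_1+\cfrac{1}{\ddots+\cfrac{1}{d_n}}}$. *)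

theory Defs
  imports "HOL-Analysis.Analysis" "HOL-Algebra.Algebra"
begin

section \<open>The groups $\mathrm{SL}(2,\mathbb{Z})$ and $\mathrm{PSL}(2,\mathbb{Z})$\<close>

definition SL2Z :: "(int^2^2) monoid" where
  "SL2Z = \<lparr>carrier = {A. det A = 1}, monoid.mult = (**), one = mat 1\<rparr>"

definition pm_one :: "(int^2^2) set" where
  "pm_one = {mat 1, - mat 1}"

definition PSL2Z :: "(int^2^2) set monoid" where
  "PSL2Z = SL2Z Mod pm_one"

definition PSL_image :: "(int^2^2) set \<Rightarrow> (int^2^2) set set" where
  "PSL_image H = (\<lambda>A. pm_one #>\<^bsub>SL2Z\<^esub> A) ` H"

text \<open>The index is only meaningful if there are finitely many cosets: it is 0 otherwise.\<close>

definition group_index :: "('a, 'b) monoid_scheme \<Rightarrow> 'a set \<Rightarrow> nat" where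
  "group_index G K = card (rcosets\<^bsub>G\<^esub> K)"


section \<open>The action on $\mathbb{Q} \cup \{\infty\}$\<close>

text \<open>The type \<^typ>\<open>rat option\<close> stands for $\mathbb{Q} \cup \{\infty\}$, with \<^term>\<open>None\<close>
  for $\infty$.\<close>

fun SL2Z_act :: "int^2^2 \<Rightarrow> rat option \<Rightarrow> rat option" where
  "SL2Z_act A None =
     (if A$2$1 = 0 then None else Some (of_int (A$1$1) / of_int (A$2$1)))"
| "SL2Z_act A (Some r) =
     (if of_int (A$2$1) * r + of_int (A$2$2) = 0 then None
      else Some ((of_int (A$1$1) * r + of_int (A$1$2)) / (of_int (A$2$1) * r + of_int (A$2$2))))"

text \<open>An element of \<^term>\<open>PSL2Z\<close> is a coset $\{A, -A\}$, and $A$ and $-A$ act in the same way.\<close>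

definition PSL_act :: "(int^2^2) set \<Rightarrow> rat option \<Rightarrow> rat option" where
  "PSL_act g x = the_elem ((\<lambda>A. SL2Z_act A x) ` g)"


section \<open>Cusps and their widths\<close>

definition PSL_restrict :: "(int^2^2) set set \<Rightarrow> (int^2^2) set monoid" where
  "PSL_restrict K = PSL2Z\<lparr>carrier := K\<rparr>"

definition cusps :: "(int^2^2) set \<Rightarrow> rat option set set" where
  "cusps H = orbits (PSL_restrict (PSL_image H)) UNIV PSL_act"

definition width_at :: "(int^2^2) set \<Rightarrow> rat option \<Rightarrow> nat" where
  "width_at H x =
     group_index (PSL_restrict (stabilizer PSL2Z PSL_act x))
       (stabilizer (PSL_restrict (PSL_image H)) PSL_act x)"

text \<open>The width does not depend on the chosen point; see \<open>cusp_width_eq\<close> below.\<close>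

definition cusp_width :: "(int^2^2) set \<Rightarrow> rat option set \<Rightarrow> nat" where
  "cusp_width H \<kappa> = width_at H (SOME x. x \<in> \<kappa>)"


section \<open>Regular continued fractions\<close>

definition gauss_map :: "real \<Rightarrow> real" where
  "gauss_map x = (if x = 0 then 0 else 1 / x - of_int \<lfloor>1 / x\<rfloor>)"

fun cf_digit :: "real \<Rightarrow> nat \<Rightarrow> int" where
  "cf_digit x 0 = \<lfloor>x\<rfloor>"
| "cf_digit x (Suc n) = \<lfloor>1 / (gauss_map ^^ n) (x - of_int \<lfloor>x\<rfloor>)\<rfloor>"

fun cf_value :: "int \<Rightarrow> int list \<Rightarrow> rat" where
  "cf_value d [] = of_int d"
| "cf_value d (e # es) = of_int d + 1 / cf_value e es"

text \<open>For irrational \<^term>\<open>x\<close> all digits of positive index are at least 1, so no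
  division by 0 occurs. For rational \<^term>\<open>x\<close> the digits are eventually junk values.\<close>

definition cf_approximant :: "real \<Rightarrow> nat \<Rightarrow> rat" where
  "cf_approximant x n = cf_value (cf_digit x 0) (map (cf_digit x) [1..<Suc n])"


section \<open>Well-definedness\<close>

lemma SL2Z_simps [simp]:
  "carrier SL2Z = {A. det A = 1}"
  "A \<otimes>\<^bsub>SL2Z\<^esub> B = A ** B"
  "\<one>\<^bsub>SL2Z\<^esub> = mat 1"
  by (simp_all add: SL2Z_def)

lemma mat2_eq_iff:
  "(A::'a^2^2) = B \<longleftrightarrow> A$1$1 = B$1$1 \<and> A$1$2 = B$1$2 \<and> A$2$1 = B$2$1 \<and> A$2$2 = B$2$2"
  by (auto simp: vec_eq_iff forall_2)

lemma mat2_mult: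
  fixes A B :: "int^2^2"
  shows "(A ** B) $ i $ j = A$i$1 * B$1$j + A$i$2 * B$2$j"
  by (simp add: matrix_matrix_mult_def sum_2)

lemma group_SL2Z: "group SL2Z"
proof (rule groupI)
  fix A assume A: "A \<in> carrier SL2Z"
  define B :: "int^2^2" where
    "B = (\<chi> i j. if i = 1 then (if j = 1 then A$2$2 else - A$1$2)
                 else (if j = 1 then - A$2$1 else A$1$1))"
  have B: "B$1$1 = A$2$2" "B$1$2 = - A$1$2" "B$2$1 = - A$2$1" "B$2$2 = A$1$1"
    by (simp_all add: B_def)
  have "B \<in> carrier SL2Z" "B \<otimes>\<^bsub>SL2Z\<^esub> A = \<one>\<^bsub>SL2Z\<^esub>"
    using A by (auto simp: mat2_eq_iff mat2_mult B det_2 mat_def algebra_simps)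
  then show "\<exists>B \<in> carrier SL2Z. B \<otimes>\<^bsub>SL2Z\<^esub> A = \<one>\<^bsub>SL2Z\<^esub>" by blast
qed (auto simp: det_mul matrix_mul_assoc)

lemma pm_one_mult: "- mat 1 ** (A::int^2^2) = - A" "A ** - mat 1 = - A"
  by (auto simp: mat2_eq_iff mat2_mult mat_def)

lemma r_coset_pm_one: "pm_one #>\<^bsub>SL2Z\<^esub> A = {A, - A}"
  by (auto simp: r_coset_def pm_one_def pm_one_mult)

lemma normal_pm_one: "pm_one \<lhd> SL2Z"
proof -
  interpret group SL2Z by (rule group_SL2Z)
  have m: "mat 1 \<in> carrier SL2Z" "- mat 1 \<in> carrier SL2Z"
    by (auto simp: det_2 mat_def)
  have "inv\<^bsub>SL2Z\<^esub> (- mat 1) = - mat 1"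
    by (rule inv_equality) (use m in \<open>auto simp: pm_one_mult\<close>)
  moreover have "inv\<^bsub>SL2Z\<^esub> (mat 1) = mat 1"
    using inv_one by simp
  ultimately have sub: "subgroup pm_one SL2Z"
    using m by unfold_locales (auto simp: pm_one_def pm_one_mult)
  show ?thesis
  proof (rule normalI[OF sub], rule ballI)
    fix A assume "A \<in> carrier SL2Z"
    show "pm_one #>\<^bsub>SL2Z\<^esub> A = A <#\<^bsub>SL2Z\<^esub> pm_one"
      by (auto simp: r_coset_def l_coset_def pm_one_def pm_one_mult)
  qed
qed

lemma group_PSL2Z: "group PSL2Z"
  unfolding PSL2Z_def by (rule normal.factorgroup_is_group[OF normal_pm_one])

lemma carrier_PSL2Z: "carrier PSL2Z = {{A, - A} | A. det A = 1}"
  by (auto simp: PSL2Z_def carrier_FactGroup r_coset_pm_one)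

definition hcoord :: "rat \<Rightarrow> rat \<Rightarrow> rat option" where
  "hcoord p q = (if q = 0 then None else Some (p / q))"

lemma hcoord_cases:
  obtains p q where "x = hcoord p q" "p \<noteq> 0 \<or> q \<noteq> 0"
proof (cases x)
  case None
  then show ?thesis using that[of 1 0] by (simp add: hcoord_def)
next
  case (Some r)
  then show ?thesis using that[of r 1] by (simp add: hcoord_def)
qed

lemma hcoord_scale: "k \<noteq> 0 \<Longrightarrow> hcoord (k * p) (k * q) = hcoord p q"
  by (simp add: hcoord_def)

lemma SL2Z_act_hcoord:
  assumes "p \<noteq> 0 \<or> q \<noteq> 0"
  shows "SL2Z_act A (hcoord p q) =
         hcoord (of_int (A$1$1) * p + of_int (A$1$2) * q) (of_int (A$2$1) * p + of_int (A$2$2) * q)"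
proof (cases "q = 0")
  case True
  then show ?thesis using assms by (simp add: hcoord_def)
next
  case False
  have "SL2Z_act A (hcoord p q) =
        hcoord (of_int (A$1$1) * (p / q) + of_int (A$1$2)) (of_int (A$2$1) * (p / q) + of_int (A$2$2))"
    using False by (simp add: hcoord_def)
  also have "\<dots> = hcoord (q * (of_int (A$1$1) * (p / q) + of_int (A$1$2)))
                        (q * (of_int (A$2$1) * (p / q) + of_int (A$2$2)))"
    by (rule hcoord_scale[OF False, symmetric])
  also have "\<dots> = hcoord (of_int (A$1$1) * p + of_int (A$1$2) * q)
                        (of_int (A$2$1) * p + of_int (A$2$2) * q)"
    using False by (simp add: algebra_simps)
  finally show ?thesis .
qed

lemma SL2Z_act_uminus: "SL2Z_act (- A) x = SL2Z_act A x"
proof -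
  obtain p q where x: "x = hcoord p q" "p \<noteq> 0 \<or> q \<noteq> 0" by (rule hcoord_cases)
  have "SL2Z_act (- A) x =
        hcoord (- 1 * (of_int (A$1$1) * p + of_int (A$1$2) * q))
               (- 1 * (of_int (A$2$1) * p + of_int (A$2$2) * q))"
    by (simp add: x(1) SL2Z_act_hcoord[OF x(2)] algebra_simps)
  also have "\<dots> = SL2Z_act A x"
    by (subst hcoord_scale) (simp_all add: x(1) SL2Z_act_hcoord[OF x(2)])
  finally show ?thesis .
qed

lemma PSL_act_eq: "PSL_act {A, - A} x = SL2Z_act A x"
  by (simp add: PSL_act_def SL2Z_act_uminus)

lemma SL2Z_act_one: "SL2Z_act (mat 1) x = x"
  by (cases x) (auto simp: mat_def)

lemma SL2Z_act_mult:
  assumes "det B = 1"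
  shows "SL2Z_act (A ** B) x = SL2Z_act A (SL2Z_act B x)"
proof -
  obtain p q where x: "x = hcoord p q" "p \<noteq> 0 \<or> q \<noteq> 0" by (rule hcoord_cases)
  define p' where "p' = of_int (B$1$1) * p + of_int (B$1$2) * q"
  define q' where "q' = of_int (B$2$1) * p + of_int (B$2$2) * q"
  have d: "rat_of_int (B$1$1) * of_int (B$2$2) - of_int (B$1$2) * of_int (B$2$1) = 1"
    using assms unfolding det_2 by (metis of_int_1 of_int_diff of_int_mult)
  have "of_int (B$2$2) * p' - of_int (B$1$2) * q'
      = (rat_of_int (B$1$1) * of_int (B$2$2) - of_int (B$1$2) * of_int (B$2$1)) * p"
    "of_int (B$1$1) * q' - of_int (B$2$1) * p'
      = (rat_of_int (B$1$1) * of_int (B$2$2) - of_int (B$1$2) * of_int (B$2$1)) * q"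
    by (simp_all add: p'_def q'_def algebra_simps)
  then have nz: "p' \<noteq> 0 \<or> q' \<noteq> 0"
    using x(2) unfolding d by auto
  have Bx: "SL2Z_act B x = hcoord p' q'"
    by (simp add: x(1) SL2Z_act_hcoord[OF x(2)] p'_def q'_def)
  have "SL2Z_act A (SL2Z_act B x) = hcoord (of_int (A$1$1) * p' + of_int (A$1$2) * q')
                                         (of_int (A$2$1) * p' + of_int (A$2$2) * q')"
    unfolding Bx by (rule SL2Z_act_hcoord[OF nz])
  also have "\<dots> = SL2Z_act (A ** B) x"
    by (simp add: x(1) SL2Z_act_hcoord[OF x(2)] mat2_mult p'_def q'_def algebra_simps)
  finally show ?thesis ..
qed

lemma PSL2Z_mult:
  "{A, - A} \<otimes>\<^bsub>PSL2Z\<^esub> {B, - B} = {A ** B, - (A ** B)}"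
proof -
  have "- A ** B = - (A ** B)" "A ** - B = - (A ** B)" "- A ** - B = A ** B"
    by (auto simp: mat2_eq_iff mat2_mult)
  then show ?thesis by (auto simp: PSL2Z_def set_mult_def)
qed

lemma PSL_act_mult:
  assumes "g \<in> carrier PSL2Z" "h \<in> carrier PSL2Z"
  shows "PSL_act (g \<otimes>\<^bsub>PSL2Z\<^esub> h) x = PSL_act g (PSL_act h x)"
  using assms by (auto simp: carrier_PSL2Z PSL2Z_mult PSL_act_eq SL2Z_act_mult)

lemma PSL_act_one: "PSL_act \<one>\<^bsub>PSL2Z\<^esub> x = x"
  by (simp add: PSL2Z_def pm_one_def PSL_act_eq SL2Z_act_one)

lemma group_action_PSL2Z: "group_action PSL2Z UNIV PSL_act"
proof -
  interpret group PSL2Z by (rule group_PSL2Z)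
  have bij: "bij (PSL_act g)" if g: "g \<in> carrier PSL2Z" for g
  proof (rule o_bij)
    show "PSL_act (inv\<^bsub>PSL2Z\<^esub> g) \<circ> PSL_act g = id"
      using g by (auto simp: fun_eq_iff PSL_act_one simp flip: PSL_act_mult)
    show "PSL_act g \<circ> PSL_act (inv\<^bsub>PSL2Z\<^esub> g) = id"
      using g by (auto simp: fun_eq_iff PSL_act_one simp flip: PSL_act_mult)
  qed
  have "PSL_act \<in> hom PSL2Z (BijGroup UNIV)"
  proof (rule homI)
    show "PSL_act g \<in> carrier (BijGroup UNIV)" if "g \<in> carrier PSL2Z" for g
      using bij[OF that] by (simp add: BijGroup_def Bij_def)
    show "PSL_act (g \<otimes>\<^bsub>PSL2Z\<^esub> h) = PSL_act g \<otimes>\<^bsub>BijGroup UNIV\<^esub> PSL_act h"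
      if "g \<in> carrier PSL2Z" "h \<in> carrier PSL2Z" for g h
      using bij[OF that(1)] bij[OF that(2)] that
      by (auto simp: BijGroup_def Bij_def compose_def fun_eq_iff PSL_act_mult)
  qed
  then show ?thesis
    by (intro group_action.intro group_hom.intro group_PSL2Z group_BijGroup group_hom_axioms.intro)
qed

lemma subgroup_PSL_image:
  assumes "subgroup H SL2Z"
  shows "subgroup (PSL_image H) PSL2Z"
proof -
  have "(\<lambda>A. pm_one #>\<^bsub>SL2Z\<^esub> A) \<in> hom SL2Z PSL2Z"
    unfolding PSL2Z_def by (rule normal.r_coset_hom_Mod[OF normal_pm_one])
  then interpret group_hom SL2Z PSL2Z "\<lambda>A. pm_one #>\<^bsub>SL2Z\<^esub> A"
    by (intro group_hom.intro group_SL2Z group_PSL2Z group_hom_axioms.intro)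
  show ?thesis
    unfolding PSL_image_def by (rule subgroup_img_is_subgroup[OF assms])
qed

lemma (in group) group_index_conj:
  assumes h: "h \<in> carrier G" and S: "S \<subseteq> carrier G" and K: "K \<subseteq> carrier G"
  defines "c \<equiv> \<lambda>g. h \<otimes> g \<otimes> inv h"
  shows "group_index (G\<lparr>carrier := c ` S\<rparr>) (c ` K) = group_index (G\<lparr>carrier := S\<rparr>) K"
proof -
  have eq: "rcosets\<^bsub>G\<lparr>carrier := T\<rparr>\<^esub> L = (\<lambda>s. L #> s) ` T" for T L
    by (auto simp: RCOSETS_def r_coset_def)
  have inj: "inj_on c (carrier G)"
    unfolding c_def using h by (auto intro!: inj_onI)
  have cancel: "inv h \<otimes> (h \<otimes> z) = z" if "z \<in> carrier G" for z
    using h that by (simp flip: m_assoc)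
  have cm: "c (a \<otimes> b) = c a \<otimes> c b" if "a \<in> carrier G" "b \<in> carrier G" for a b
    using h that cancel by (simp add: c_def m_assoc)
  have "c ` (K #> s) = c ` K #> c s" if "s \<in> S" for s
  proof -
    have "c ` (K #> s) = (\<lambda>k. c (k \<otimes> s)) ` K"
      by (auto simp: r_coset_def)
    also have "\<dots> = (\<lambda>k. c k \<otimes> c s) ` K"
      by (intro image_cong refl cm) (use K S that in auto)
    also have "\<dots> = c ` K #> c s"
      by (auto simp: r_coset_def)
    finally show ?thesis .
  qed
  then have "(\<lambda>s. c ` K #> s) ` c ` S = (`) c ` (\<lambda>s. K #> s) ` S"
    by (simp add: image_image)
  moreover have "inj_on ((`) c) ((\<lambda>s. K #> s) ` S)"
  proof (rule inj_on_subset[OF inj_on_image_Pow[OF inj]])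
    show "(\<lambda>s. K #> s) ` S \<subseteq> Pow (carrier G)"
      using K S r_coset_subset_G by blast
  qed
  ultimately show ?thesis
    by (simp add: group_index_def eq card_image)
qed

lemma width_at_act:
  assumes H: "subgroup H SL2Z" and h: "h \<in> PSL_image H"
  shows "width_at H (PSL_act h x) = width_at H x"
proof -
  interpret group PSL2Z by (rule group_PSL2Z)
  interpret K: subgroup "PSL_image H" PSL2Z by (rule subgroup_PSL_image[OF H])
  define c where "c = (\<lambda>g. h \<otimes>\<^bsub>PSL2Z\<^esub> g \<otimes>\<^bsub>PSL2Z\<^esub> inv\<^bsub>PSL2Z\<^esub> h)"
  have hG: "h \<in> carrier PSL2Z" using h by simp
  have stab: "{g \<in> L. PSL_act g (PSL_act h x) = PSL_act h x} = c ` {g \<in> L. PSL_act g x = x}"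
    if L: "subgroup L PSL2Z" "h \<in> L" for L
  proof (intro equalityI subsetI)
    interpret L: subgroup L PSL2Z by (rule L)
    fix g assume g: "g \<in> {g \<in> L. PSL_act g (PSL_act h x) = PSL_act h x}"
    define k where "k = inv\<^bsub>PSL2Z\<^esub> h \<otimes>\<^bsub>PSL2Z\<^esub> g \<otimes>\<^bsub>PSL2Z\<^esub> h"
    have gG: "g \<in> carrier PSL2Z" using g by simp
    have "k \<in> L" using g L(2) by (simp add: k_def)
    moreover have "PSL_act k x = PSL_act (inv\<^bsub>PSL2Z\<^esub> h) (PSL_act h x)"
      using g gG hG by (simp add: k_def PSL_act_mult)
    then have "PSL_act k x = x"
      using hG by (simp add: PSL_act_one flip: PSL_act_mult)
    moreover have "g = c k"
      using gG hG by (simp add: c_def k_def m_assoc) (simp flip: m_assoc)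
    ultimately show "g \<in> c ` {g \<in> L. PSL_act g x = x}" by blast
  next
    interpret L: subgroup L PSL2Z by (rule L)
    fix g assume "g \<in> c ` {g \<in> L. PSL_act g x = x}"
    then obtain k where k: "k \<in> L" "PSL_act k x = x" "g = c k" by blast
    have "PSL_act (c k) (PSL_act h x) = PSL_act (c k \<otimes>\<^bsub>PSL2Z\<^esub> h) x"
      using k hG by (simp add: c_def PSL_act_mult)
    also have "c k \<otimes>\<^bsub>PSL2Z\<^esub> h = h \<otimes>\<^bsub>PSL2Z\<^esub> k"
      using k hG by (simp add: c_def m_assoc)
    finally show "g \<in> {g \<in> L. PSL_act g (PSL_act h x) = PSL_act h x}"
      using k L(2) hG by (simp add: c_def PSL_act_mult)
  qed
  have "width_at H y = group_index (PSL2Z\<lparr>carrier := {g \<in> carrier PSL2Z. PSL_act g y = y}\<rparr>)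
                         {g \<in> PSL_image H. PSL_act g y = y}" for y
    by (simp add: width_at_def PSL_restrict_def stabilizer_def)
  then show ?thesis
    using group_index_conj[OF hG, of "{g \<in> carrier PSL2Z. PSL_act g x = x}"
        "{g \<in> PSL_image H. PSL_act g x = x}"] K.subset
    unfolding c_def[symmetric] stab[OF subgroup_self hG, symmetric]
      stab[OF subgroup_PSL_image[OF H] h, symmetric]
    by auto
qed

lemma width_at_eq:
  assumes "subgroup H SL2Z" "\<kappa> \<in> cusps H" "x \<in> \<kappa>" "y \<in> \<kappa>"
  shows "width_at H x = width_at H y"
proof -
  obtain z where "\<kappa> = orbit (PSL_restrict (PSL_image H)) PSL_act z"
    using assms(2) by (auto simp: cusps_def orbits_def)
  then have "\<And>x. x \<in> \<kappa> \<Longrightarrow> width_at H x = width_at H z"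
    using width_at_act[OF assms(1)] by (auto simp: orbit_def PSL_restrict_def)
  then show ?thesis using assms(3,4) by simp
qed

lemma cusp_width_eq:
  assumes "subgroup H SL2Z" "\<kappa> \<in> cusps H" "x \<in> \<kappa>"
  shows "cusp_width H \<kappa> = width_at H x"
  unfolding cusp_width_def
  by (rule width_at_eq[OF assms(1,2) someI[of "\<lambda>x. x \<in> \<kappa>"] assms(3)]) (rule assms(3))

end

(* For x with digits d_0, d_1, ... the pair (p_n, q_n) is the first column of the product of the
   matrices [[d_i, 1], [1, 0]], so whether p_n/q_n lies in a given cusp depends only on the coset of
   this product in the finite space of right cosets of {A, -A | A in H} in GL(2,Z). The digit matrices
   act on this space by permutations, transitively because they generate GL(2,Z) up to sign
   (Euclid), and it remains to show that for almost every x all cosets are visited equally often.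

   No ergodic theorem is used. Fix a target coset t and c > 1/|S|, and let B(s) be the set of x for
   which (number of visits to t before time N) - c N is unbounded above, starting from s. These
   sets are exactly invariant under the skew product, so bounded distortion of the Gauss map on
   cylinders, together with the finiteness and transitivity of the action, shows that either all
   B(s) are null or all are conull. In the second case a stopping time argument bounds the number
   of visits from below by about c N for every s; but the digits act by permutations, so summing over
   the start s gives exactly N, which contradicts c |S| > 1. Hence every upper frequency is at most
   1/|S|, and since the frequencies sum to 1 they all converge to 1/|S|. *)

theory Submission
  imports Defs
begin

section \<open>Cylinders and inverse branches of the Gauss map\<close>

text \<open>Lebesgue measure itself is used in place of the invariant Gauss measure: an inverse
  branch is a Moebius map whose denominator varies by a factor of at most 2 on the unit interval, so
  every distortion constant is 4, and preimages under all iterates grow by at most this factor. The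
  digit matrices have determinant -1, so the products alternate between both determinants and the
  state space must contain cosets of either sign. This doubles every count: twice the index many
  cosets in all, twice the width many leading into a cusp, hence the same quotient. The integer part
  of \<open>x\<close> is not a digit of the Gauss map and can be any integer; it only selects the
  starting coset, which is why visits are studied from every start. Transitivity is needed by words
  of positive digits, without inverses. Finiteness supplies the inverses: an injective map of the
  finite set of reachable cosets into itself is onto.\<close>

definition irr_unit :: "real set" where
  "irr_unit = {0<..<1} - \<rat>"

definition first_digit :: "real \<Rightarrow> nat" where
  "first_digit x = nat \<lfloor>1 / x\<rfloor>"

fun digits :: "nat \<Rightarrow> real \<Rightarrow> nat list" where
  "digits 0 x = []"
| "digits (Suc n) x = first_digit x # digits n (gauss_map x)"

definition cylinder :: "nat list \<Rightarrow> real set" where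
  "cylinder w = {x \<in> irr_unit. digits (length w) x = w}"

text \<open>The finite continued fraction with tail \<open>y\<close>; for positive digits, the
  inverse branch of the iterate of order \<open>length w\<close> on
  \<open>cylinder w\<close>.\<close>

fun branch :: "nat list \<Rightarrow> real \<Rightarrow> real" where
  "branch [] y = y"
| "branch (d # w) y = 1 / (real d + branch w y)"

abbreviation words :: "nat list set" where
  "words \<equiv> {w. \<forall>d\<in>set w. 0 < d}"

lemma irr_unitD: "x \<in> irr_unit \<Longrightarrow> 0 < x" "x \<in> irr_unit \<Longrightarrow> x < 1" "x \<in> irr_unit \<Longrightarrow> x \<notin> \<rat>"
  by (auto simp: irr_unit_def)

lemma gauss_map_eq_frac: "gauss_map x = frac (1 / x)"
  by (auto simp: gauss_map_def frac_def)

lemma gauss_map_in_irr_unit: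
  assumes "x \<in> irr_unit"
  shows "gauss_map x \<in> irr_unit"
proof -
  have irr: "1 / x \<notin> \<rat>"
    using irr_unitD[OF assms] Rats_divide[of 1 "1/x"] by auto
  have "frac (1 / x) \<notin> \<rat>"
  proof
    assume "frac (1 / x) \<in> \<rat>"
    then have "frac (1 / x) + of_int \<lfloor>1 / x\<rfloor> \<in> \<rat>" by (intro Rats_add) auto
    with irr show False by (simp add: frac_def)
  qed
  moreover have "frac (1 / x) \<noteq> 0" using calculation by (metis Rats_0)
  ultimately show ?thesis
    using frac_ge_0[of "1/x"] frac_lt_1[of "1/x"]
    by (simp add: irr_unit_def gauss_map_eq_frac)
qed

lemma gauss_map_iter_in_irr_unit: "x \<in> irr_unit \<Longrightarrow> (gauss_map ^^ n) x \<in> irr_unit"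
  by (induction n) (auto intro: gauss_map_in_irr_unit)

lemma first_digit_pos: "x \<in> irr_unit \<Longrightarrow> 0 < first_digit x"
  by (auto simp: first_digit_def irr_unit_def zero_less_nat_eq)

lemma first_digit_gauss_map:
  assumes "x \<in> irr_unit"
  shows "1 / (real (first_digit x) + gauss_map x) = x"
proof -
  have "\<lfloor>1 / x\<rfloor> \<ge> 0" using irr_unitD[OF assms] by simp
  then show ?thesis
    by (simp add: first_digit_def gauss_map_eq_frac frac_def)
qed

lemma branch_step:
  assumes "y \<in> irr_unit" "0 < d"
  shows "1 / (real d + y) \<in> irr_unit" "first_digit (1 / (real d + y)) = d"
    "gauss_map (1 / (real d + y)) = y"
proof -
  have y: "0 < y" "y < 1" "y \<notin> \<rat>" using assms by (auto simp: irr_unit_def)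
  have fl: "\<lfloor>real d + y\<rfloor> = int d" using y by (intro floor_unique) auto
  have "real d + y \<notin> \<rat>"
    using y(3) Rats_diff[of "real d + y" "real d"] by auto
  then have "1 / (real d + y) \<notin> \<rat>"
    using Rats_divide[of 1 "1 / (real d + y)"] by auto
  moreover have "real d + y > 1" using y assms(2) by linarith
  ultimately show "1 / (real d + y) \<in> irr_unit" by (simp add: irr_unit_def)
  show "first_digit (1 / (real d + y)) = d" "gauss_map (1 / (real d + y)) = y"
    by (simp_all add: first_digit_def gauss_map_eq_frac frac_def fl)
qed

lemma length_digits [simp]: "length (digits n x) = n"
  by (induction n arbitrary: x) auto

lemma digits_in_words: "x \<in> irr_unit \<Longrightarrow> digits n x \<in> words"
proof (induction n arbitrary: x)
  case (Suc n)
  show ?case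
    using Suc.IH[OF gauss_map_in_irr_unit[OF Suc.prems]] first_digit_pos[OF Suc.prems] by auto
qed auto

lemma digits_add: "digits (m + n) x = digits m x @ digits n ((gauss_map ^^ m) x)"
  by (induction m arbitrary: x) (simp_all add: funpow_Suc_right del: funpow.simps(2))

lemma branch_irr_unit:
  "y \<in> irr_unit \<Longrightarrow> w \<in> words \<Longrightarrow> branch w y \<in> irr_unit \<and> digits (length w) (branch w y) = w \<and>
     (gauss_map ^^ length w) (branch w y) = y"
proof (induction w)
  case (Cons d w)
  then have IH: "branch w y \<in> irr_unit" "digits (length w) (branch w y) = w"
    "(gauss_map ^^ length w) (branch w y) = y" "0 < d" by auto
  show ?case
    using IH branch_step[OF IH(1,4)] by (simp add: funpow_Suc_right del: funpow.simps(2))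
qed auto

lemma branch_digits: "x \<in> irr_unit \<Longrightarrow> branch (digits n x) ((gauss_map ^^ n) x) = x"
  by (induction n arbitrary: x)
    (simp_all add: funpow_Suc_right first_digit_gauss_map gauss_map_in_irr_unit del: funpow.simps(2))

text \<open>On its cylinder the iterated Gauss map inverts \<open>branch w\<close>, so images turn
  into preimages. Borel measurability of images and the self-similarity of invariant sets both come
  from this.\<close>

lemma branch_image:
  assumes "w \<in> words" "E \<subseteq> irr_unit"
  shows "branch w ` E = {x \<in> cylinder w. (gauss_map ^^ length w) x \<in> E}"
proof (intro equalityI subsetI)
  fix x assume "x \<in> branch w ` E"
  then show "x \<in> {x \<in> cylinder w. (gauss_map ^^ length w) x \<in> E}"
    using branch_irr_unit assms by (auto simp: cylinder_def)
next
  fix x assume x: "x \<in> {x \<in> cylinder w. (gauss_map ^^ length w) x \<in> E}"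
  then have "branch w ((gauss_map ^^ length w) x) = x"
    using branch_digits[of x "length w"] by (auto simp: cylinder_def)
  with x show "x \<in> branch w ` E" by (metis (mono_tags, lifting) image_eqI mem_Collect_eq)
qed

lemma cylinder_eq_branch_image: "w \<in> words \<Longrightarrow> cylinder w = branch w ` irr_unit"
  by (subst branch_image) (auto simp: cylinder_def gauss_map_iter_in_irr_unit)

lemma cylinder_subset: "cylinder w \<subseteq> irr_unit"
  by (auto simp: cylinder_def)

section \<open>Measurability of digits and cylinders\<close>

lemma borel_measurable_gauss_map [measurable]: "gauss_map \<in> borel_measurable borel"
  unfolding gauss_map_eq_frac[abs_def] frac_def by measurable

lemma borel_measurable_gauss_map_iter [measurable]: "gauss_map ^^ n \<in> borel_measurable borel"
  by (induction n) auto

lemma measurable_first_digit [measurable]: "first_digit \<in> measurable borel (count_space UNIV)"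
  unfolding first_digit_def[abs_def] by measurable

lemma irr_unit_borel [measurable]: "irr_unit \<in> sets borel"
proof -
  have "countable (\<rat> :: real set)" by (rule countable_rat)
  then have "(\<rat> :: real set) \<in> sets borel" by (rule sets.countable[rotated]) auto
  then show ?thesis unfolding irr_unit_def by auto
qed

lemma measurable_digits [measurable]: "digits n \<in> measurable borel (count_space UNIV)"
proof (induction n)
  case 0
  have "digits 0 = (\<lambda>_. [])" by (rule ext) simp
  then show ?case by simp
next
  case (Suc n)
  have "(\<lambda>x. d # digits n (gauss_map x)) \<in> measurable borel (count_space UNIV)" for d
    by (rule measurable_compose[OF measurable_compose[OF borel_measurable_gauss_map Suc.IH]]) simp
  then have "(\<lambda>x. first_digit x # digits n (gauss_map x)) \<in> measurable borel (count_space UNIV)"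
    by (rule measurable_compose_countable[OF _ measurable_first_digit])
  moreover have "digits (Suc n) = (\<lambda>x. first_digit x # digits n (gauss_map x))"
    by (rule ext) simp
  ultimately show ?case by simp
qed

lemma cylinder_borel [measurable]: "cylinder w \<in> sets borel"
proof -
  have "cylinder w = irr_unit \<inter> digits (length w) -` {w} \<inter> space borel"
    by (auto simp: cylinder_def)
  then show ?thesis using measurable_sets[OF measurable_digits, of "{w}" "length w"] by auto
qed

lemma emeasure_irr_unit: "emeasure lborel irr_unit = 1"
proof -
  have "emeasure lborel (\<rat> :: real set) = 0"
    using countable_imp_null_set_lborel[OF countable_rat] by auto
  then have "emeasure lborel irr_unit = emeasure lborel {0<..<1::real}"
    unfolding irr_unit_def
    by (intro emeasure_Diff_null_set) (auto intro: countable_imp_null_set_lborel countable_rat)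
  then show ?thesis by simp
qed

text \<open>The coefficients constructed are continuants: \<open>a\<close>, \<open>c\<close> and
  \<open>b\<close>, \<open>e\<close> are the numerators and denominators of the last two convergents
  of the continued fraction with digits \<open>w\<close>. The linear growth of \<open>c\<close> in
  the length is what makes cylinders shrink.\<close>

lemma branch_moebius:
  assumes "w \<in> words"
  obtains a b c e :: real where
    "0 \<le> a" "0 \<le> b" "0 \<le> e" "1 \<le> c" "real (length w) \<le> c" "e \<le> c" "\<bar>b * c - a * e\<bar> = 1"
    "\<And>y. y \<in> {0..1} \<Longrightarrow> branch w y = (a + b * y) / (c + e * y)"
proof -
  \<comment> \<open>Digits are prepended, so \<open>e \<le> c\<close> alone does not survive the
    induction, and \<open>b \<le> a\<close> fails for the empty word; the sum
    \<open>e + b \<le> c + a\<close> holds there and carries over. The disjunction supplies the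
    extra 1 for the length bound.\<close>
  have "\<exists>a b c e :: real. 0 \<le> a \<and> 0 \<le> b \<and> 0 \<le> e \<and> 1 \<le> c \<and> real (length w) \<le> c \<and> e \<le> c \<and>
     e + b \<le> c + a \<and> (w = [] \<or> 1 \<le> a) \<and> \<bar>b * c - a * e\<bar> = 1 \<and>
     (\<forall>y\<in>{0..1}. branch w y = (a + b * y) / (c + e * y))"
    using assms
  proof (induction w)
    case Nil
    show ?case by (rule exI[of _ 0], rule exI[of _ 1], rule exI[of _ 1], rule exI[of _ 0]) auto
  next
    case (Cons d w)
    then have "w \<in> words" by simp
    from Cons.IH[OF this] obtain a b c e :: real where IH: "0 \<le> a" "0 \<le> b" "0 \<le> e" "1 \<le> c" "real (length w) \<le> c"
      "e \<le> c" "e + b \<le> c + a" "w = [] \<or> 1 \<le> a" "\<bar>b * c - a * e\<bar> = 1"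
      "\<And>y. y \<in> {0..1} \<Longrightarrow> branch w y = (a + b * y) / (c + e * y)"
      by blast
    define D where "D = real d"
    have D: "1 \<le> D" using Cons.prems by (auto simp: D_def)
    have Dc: "c \<le> D * c" using D IH(4) by simp
    have "0 \<le> (D - 1) * (c - e)" using D IH by simp
    then have m: "D * e + b \<le> D * c + a" using IH(7) by (simp add: algebra_simps)
    have "branch (d # w) y = (c + e * y) / ((D * c + a) + (D * e + b) * y)" if "y \<in> {0..1}" for y
    proof -
      have K: "c + e * y > 0" using IH that by (auto intro: add_pos_nonneg)
      then have "D + (a + b * y) / (c + e * y) = ((D * c + a) + (D * e + b) * y) / (c + e * y)"
        by (simp add: field_simps)
      then show ?thesis using IH(10)[OF that] by (simp add: D_def)
    qed
    moreover have "real (length (d # w)) \<le> D * c + a"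
    proof -
      have "w = [] \<Longrightarrow> real (length w) = 0" by simp
      then have "real (length w) + 1 \<le> D * c + a"
        using Dc IH(1,4,5,8) by linarith
      then show ?thesis by simp
    qed
    moreover have "\<bar>e * (D * c + a) - c * (D * e + b)\<bar> = 1"
      using IH(9) by (simp add: algebra_simps)
    moreover have "D * e + b + e \<le> D * c + a + c" using m IH(6) by simp
    moreover have "0 \<le> c" "0 \<le> D * e + b" "1 \<le> D * c + a"
    proof -
      show "0 \<le> D * e + b" using IH(2,3) D by simp
      show "0 \<le> c" "1 \<le> D * c + a" using IH(1,4) Dc by linarith+
    qed
    ultimately have "0 \<le> c \<and> 0 \<le> e \<and> 0 \<le> D * e + b \<and> 1 \<le> D * c + a \<and>
        real (length (d # w)) \<le> D * c + a \<and> D * e + b \<le> D * c + a \<and>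
        D * e + b + e \<le> D * c + a + c \<and> (d # w = [] \<or> 1 \<le> c) \<and>
        \<bar>e * (D * c + a) - c * (D * e + b)\<bar> = 1 \<and>
        (\<forall>y\<in>{0..1}. branch (d # w) y = (c + e * y) / ((D * c + a) + (D * e + b) * y))"
      using IH(3,4) m by blast
    then show ?case by blast
  qed
  then show ?thesis using that by blast
qed

text \<open>The derivative is the determinant divided by the square of \<open>c + e * y\<close>, and
  this denominator lies between \<open>c\<close> and \<open>2 * c\<close>. This is the origin of the
  distortion factor 4.\<close>

lemma branch_derivative:
  assumes "w \<in> words"
  obtains c :: real and g' where "1 \<le> c" "real (length w) \<le> c" "continuous_on {0..1} g'"
    "\<And>y. y \<in> {0..1} \<Longrightarrow> (branch w has_field_derivative g' y) (at y within {0..1})"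
    "\<And>y. y \<in> {0..1} \<Longrightarrow> 1 / (4 * c\<^sup>2) \<le> \<bar>g' y\<bar>" "\<And>y. y \<in> {0..1} \<Longrightarrow> \<bar>g' y\<bar> \<le> 1 / c\<^sup>2"
proof -
  obtain a b c e :: real where h:
    "0 \<le> a" "0 \<le> b" "0 \<le> e" "1 \<le> c" "real (length w) \<le> c" "e \<le> c" "\<bar>b * c - a * e\<bar> = 1"
    and eq: "\<And>y. y \<in> {0..1} \<Longrightarrow> branch w y = (a + b * y) / (c + e * y)"
    by (rule branch_moebius[OF assms]) (rule that)
  define g' where "g' y = (b * c - a * e) / (c + e * y)\<^sup>2" for y
  have bd: "c \<le> c + e * y" "c + e * y \<le> 2 * c" if "y \<in> {0..1}" for y
  proof -
    have "e * y \<le> c * 1" using h that by (intro mult_mono) auto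
    then show "c \<le> c + e * y" "c + e * y \<le> 2 * c" using h that by auto
  qed
  have pos: "0 < c + e * y" if "y \<in> {0..1}" for y using bd[OF that] h by linarith
  show ?thesis
  proof (rule that[of c g'])
    show "continuous_on {0..1} g'"
      unfolding g'_def by (intro continuous_intros) (use pos in force)
    fix y :: real assume y: "y \<in> {0..1}"
    have "((\<lambda>y. (a + b * y) / (c + e * y)) has_field_derivative g' y) (at y within {0..1})"
      unfolding g'_def using pos[OF y]
      by (auto intro!: derivative_eq_intros simp: power2_eq_square field_simps)
    then show "(branch w has_field_derivative g' y) (at y within {0..1})"
      by (rule has_field_derivative_transform_within[OF _ zero_less_one y]) (use eq in auto)
    have sq: "c\<^sup>2 \<le> (c + e * y)\<^sup>2" "(c + e * y)\<^sup>2 \<le> (2 * c)\<^sup>2"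
      using bd[OF y] h(4) by (intro power_mono; linarith)+
    have g: "\<bar>g' y\<bar> = 1 / (c + e * y)\<^sup>2" using h(7) by (simp add: g'_def)
    show "1 / (4 * c\<^sup>2) \<le> \<bar>g' y\<bar>" "\<bar>g' y\<bar> \<le> 1 / c\<^sup>2"
      unfolding g using sq h(4) pos[OF y] by (auto intro!: divide_left_mono simp: power_mult_distrib)
  qed (use h in auto)
qed

section \<open>Lebesgue measure under the inverse branches\<close>

lemma branch_inj: "w \<in> words \<Longrightarrow> inj_on (branch w) irr_unit"
  by (rule inj_on_inverseI[where g = "gauss_map ^^ length w"]) (use branch_irr_unit in auto)

lemma irr_unit_subset: "irr_unit \<subseteq> {0..1}"
  by (auto simp: irr_unit_def)

lemma branch_image_borel [measurable]:
  assumes "w \<in> words" "E \<in> sets borel" "E \<subseteq> irr_unit"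
  shows "branch w ` E \<in> sets borel"
proof -
  have "branch w ` E = cylinder w \<inter> ((gauss_map ^^ length w) -` E \<inter> space borel)"
    using branch_image[OF assms(1,3)] by auto
  also have "\<dots> \<in> sets borel"
    using measurable_sets[OF borel_measurable_gauss_map_iter assms(2)] by (intro sets.Int) auto
  finally show ?thesis .
qed

abbreviation lam :: "real set \<Rightarrow> real" where
  "lam \<equiv> measure lborel"

lemma lmeasurable_subset_irr_unit:
  assumes "E \<in> sets borel" "E \<subseteq> irr_unit"
  shows "E \<in> lmeasurable" "E \<in> fmeasurable lborel"
proof -
  have "emeasure lborel E \<le> emeasure lborel {0..1::real}"
    using assms irr_unit_subset by (intro emeasure_mono) auto
  then show "E \<in> fmeasurable lborel" using assms by (auto simp: fmeasurable_def intro: le_less_trans[OF _ ennreal_one_less_top])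
  then show "E \<in> lmeasurable" by (auto simp: fmeasurable_def)
qed

lemma branch_image_measure:
  assumes "w \<in> words"
  obtains c :: real where "1 \<le> c"
    "\<And>E. E \<in> sets borel \<Longrightarrow> E \<subseteq> irr_unit \<Longrightarrow> lam E / (4 * c\<^sup>2) \<le> lam (branch w ` E)"
    "\<And>E. E \<in> sets borel \<Longrightarrow> E \<subseteq> irr_unit \<Longrightarrow> lam (branch w ` E) \<le> lam E / c\<^sup>2"
proof -
  obtain c :: real and g' where g: "1 \<le> c" "real (length w) \<le> c"
    "continuous_on {0..1} g'"
    "\<And>y. y \<in> {0..1} \<Longrightarrow> (branch w has_field_derivative g' y) (at y within {0..1})"
    "\<And>y. y \<in> {0..1} \<Longrightarrow> 1 / (4 * c\<^sup>2) \<le> \<bar>g' y\<bar>" "\<And>y. y \<in> {0..1} \<Longrightarrow> \<bar>g' y\<bar> \<le> 1 / c\<^sup>2"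
    by (rule branch_derivative[OF assms]) (rule that)
  have "lam E / (4 * c\<^sup>2) \<le> lam (branch w ` E) \<and> lam (branch w ` E) \<le> lam E / c\<^sup>2"
    if E: "E \<in> sets borel" "E \<subseteq> irr_unit" for E
  proof -
    have E01: "E \<subseteq> {0..1}" using E irr_unit_subset by blast
    have El: "E \<in> lmeasurable" by (rule lmeasurable_subset_irr_unit[OF E])
    have bE: "branch w ` E \<in> sets borel" "branch w ` E \<subseteq> irr_unit"
      using branch_image_borel[OF assms E] branch_image[OF assms E(2)] cylinder_subset by auto
    have bl: "branch w ` E \<in> lmeasurable" by (rule lmeasurable_subset_irr_unit[OF bE])
    have "(\<lambda>y. \<bar>g' y\<bar>) absolutely_integrable_on {0..1}"
      by (intro absolutely_integrable_continuous_real continuous_intros g)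
    then have ai: "(\<lambda>y. \<bar>g' y\<bar>) absolutely_integrable_on E"
      by (rule set_integrable_subset) (use E01 E in auto)
    \<comment> \<open>Change of variables for the constant function 1, whose integral over the image
      is the measure of the image.\<close>
    have "(\<lambda>x. \<bar>g' x\<bar> * 1) absolutely_integrable_on E \<and>
           integral E (\<lambda>x. \<bar>g' x\<bar> * 1) = integral E (\<lambda>x. \<bar>g' x\<bar>)
     \<longleftrightarrow> (\<lambda>_. 1::real) absolutely_integrable_on (branch w ` E) \<and>
        integral (branch w ` E) (\<lambda>_. 1::real) = integral E (\<lambda>x. \<bar>g' x\<bar>)"
    proof (rule has_absolute_integral_change_of_variables_1')
      show "E \<in> sets lebesgue" using E by auto
      show "(branch w has_field_derivative g' x) (at x within E)" if "x \<in> E" for x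
        using g(4)[of x] that E01 by (blast intro: has_field_derivative_subset)
      show "inj_on (branch w) E" using branch_inj[OF assms] E(2) by (rule inj_on_subset)
    qed
    then have "integral (branch w ` E) (\<lambda>_. 1::real) = integral E (\<lambda>x. \<bar>g' x\<bar>)"
      using ai by simp
    then have eq: "lam (branch w ` E) = integral E (\<lambda>x. \<bar>g' x\<bar>)"
      using lmeasure_integral[OF bl] bE(1) by (simp add: measure_completion)
    have io: "(\<lambda>y. \<bar>g' y\<bar>) integrable_on E" using ai set_lebesgue_integral_eq_integral(1) by blast
    have const: "(\<lambda>_. k) integrable_on E" "integral E (\<lambda>_. k) = lam E * k" for k :: real
    proof -
      have "((\<lambda>_. 1::real) has_integral lam E) E"
        using has_integral_measure_lborel[of E] lmeasurable_subset_irr_unit[OF E] E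
        by (auto simp: fmeasurable_def)
      then have "((\<lambda>_. 1 * k) has_integral lam E * k) E" by (rule has_integral_mult_left)
      then show "(\<lambda>_. k) integrable_on E" "integral E (\<lambda>_. k) = lam E * k"
        by (auto simp: has_integral_iff)
    qed
    have "integral E (\<lambda>_. 1 / (4 * c\<^sup>2)) \<le> integral E (\<lambda>x. \<bar>g' x\<bar>)"
      by (rule integral_le) (use const io g E01 in auto)
    moreover have "integral E (\<lambda>x. \<bar>g' x\<bar>) \<le> integral E (\<lambda>_. 1 / c\<^sup>2)"
      by (rule integral_le) (use const io g E01 in auto)
    ultimately show ?thesis unfolding eq const by simp
  qed
  then show ?thesis using that g(1) by blast
qed

lemma lam_irr_unit: "lam irr_unit = 1"
  using emeasure_irr_unit by (simp add: measure_def)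

text \<open>The choice \<open>E = irr_unit\<close> places the measure of the cylinder itself between
  \<open>1 / (4 * c\<^sup>2)\<close> and \<open>1 / c\<^sup>2\<close>, which eliminates
  \<open>c\<close>. Relative to its cylinder, a set keeps its proportion up to a factor 4, uniformly
  in \<open>w\<close>.\<close>

lemma branch_distortion:
  assumes "w \<in> words" "E \<in> sets borel" "E \<subseteq> irr_unit"
  shows "lam (branch w ` E) \<le> 4 * lam (cylinder w) * lam E"
    and "lam (cylinder w) * lam E \<le> 4 * lam (branch w ` E)"
    and "0 < lam (cylinder w)"
proof -
  obtain c :: real where c: "1 \<le> c"
    "\<And>E. E \<in> sets borel \<Longrightarrow> E \<subseteq> irr_unit \<Longrightarrow> lam E / (4 * c\<^sup>2) \<le> lam (branch w ` E)"
    "\<And>E. E \<in> sets borel \<Longrightarrow> E \<subseteq> irr_unit \<Longrightarrow> lam (branch w ` E) \<le> lam E / c\<^sup>2"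
    by (rule branch_image_measure[OF assms(1)]) (rule that)
  have cyl: "1 / (4 * c\<^sup>2) \<le> lam (cylinder w)" "lam (cylinder w) \<le> 1 / c\<^sup>2"
    using c(2,3)[of irr_unit] by (simp_all add: cylinder_eq_branch_image[OF assms(1)] lam_irr_unit)
  have "lam E / c\<^sup>2 = 4 * (1 / (4 * c\<^sup>2)) * lam E" by simp
  also have "\<dots> \<le> 4 * lam (cylinder w) * lam E"
    using cyl by (intro mult_right_mono mult_left_mono) auto
  finally show "lam (branch w ` E) \<le> 4 * lam (cylinder w) * lam E"
    using c(3)[OF assms(2,3)] by linarith
  have "lam (cylinder w) * lam E \<le> 1 / c\<^sup>2 * lam E"
    using cyl by (intro mult_right_mono) auto
  also have "\<dots> = 4 * (lam E / (4 * c\<^sup>2))" by simp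
  finally show "lam (cylinder w) * lam E \<le> 4 * lam (branch w ` E)"
    using c(2)[OF assms(2,3)] by linarith
  have "0 < 1 / (4 * c\<^sup>2)" using c(1) by simp
  then show "0 < lam (cylinder w)" using cyl(1) by linarith
qed

text \<open>Mean value bound with derivative at most \<open>1 / c\<^sup>2\<close> and
  \<open>length w \<le> c\<close>. The empty word is excluded because \<open>1 / 0\<close> is
  0.\<close>

lemma cylinder_diameter:
  assumes "w \<in> words" "x \<in> cylinder w" "y \<in> cylinder w" "w \<noteq> []"
  shows "\<bar>x - y\<bar> \<le> 1 / real (length w)"
proof -
  obtain c :: real and g' where g: "1 \<le> c" "real (length w) \<le> c"
    "\<And>y. y \<in> {0..1} \<Longrightarrow> (branch w has_field_derivative g' y) (at y within {0..1})"
    "\<And>y. y \<in> {0..1} \<Longrightarrow> \<bar>g' y\<bar> \<le> 1 / c\<^sup>2"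
    by (rule branch_derivative[OF assms(1)]) (rule that)
  obtain x' y' where xy: "x' \<in> irr_unit" "y' \<in> irr_unit" "x = branch w x'" "y = branch w y'"
    using assms by (auto simp: cylinder_eq_branch_image)
  then have u: "x' \<in> {0..1}" "y' \<in> {0..1}" using irr_unit_subset by auto
  have "norm (branch w x' - branch w y') \<le> (1 / c\<^sup>2) * norm (x' - y')"
    by (rule field_differentiable_bound[of "{0..1}"]) (use g u in auto)
  also have "\<dots> \<le> (1 / c\<^sup>2) * 1" using u by (intro mult_left_mono) auto
  also have "\<dots> \<le> 1 / c"
    using g(1) by (simp add: power2_eq_square field_simps)
  also have "\<dots> \<le> 1 / real (length w)"
    using g(1,2) assms(4) by (intro divide_left_mono) auto
  finally show ?thesis using xy by simp
qed

section \<open>Finite extensions of the Gauss map\<close>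

lemma cylinder_disjoint:
  "length v = length w \<Longrightarrow> v \<noteq> w \<Longrightarrow> cylinder v \<inter> cylinder w = {}"
  by (auto simp: cylinder_def)

lemma countable_words: "countable (W :: nat list set)"
  by (rule countableI_type)

text \<open>Cylinders of one length are disjoint but may be infinitely many, so the sum is taken in
  \<open>ennreal\<close> as an integral over \<open>count_space W\<close>, and only the totals are
  turned back into reals.\<close>

lemma lam_UN_cylinder_le:
  assumes W: "\<And>w. w \<in> W \<Longrightarrow> length w = n"
    and F: "\<And>w. w \<in> W \<Longrightarrow> F w \<in> sets borel" "\<And>w. w \<in> W \<Longrightarrow> F w \<subseteq> cylinder w"
      "\<And>w. w \<in> W \<Longrightarrow> lam (F w) \<le> k * lam (cylinder w)"
    and k: "0 \<le> k"
  shows "lam (\<Union>w\<in>W. F w) \<le> k * lam (\<Union>w\<in>W. cylinder w)"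
proof -
  have fin: "emeasure lborel A = ennreal (lam A)" if "A \<in> sets borel" "A \<subseteq> irr_unit" for A
    using lmeasurable_subset_irr_unit(2)[OF that] by (rule emeasure_eq_measure2)
  have disjC: "disjoint_family_on cylinder W"
    unfolding disjoint_family_on_def using W cylinder_disjoint by metis
  then have disjF: "disjoint_family_on F W"
    unfolding disjoint_family_on_def using F(2) by blast
  have FW: "(\<Union>w\<in>W. F w) \<in> sets borel" "(\<Union>w\<in>W. F w) \<subseteq> irr_unit"
    using F cylinder_subset by (auto intro!: sets.countable_UN' countable_words) blast
  have CW: "(\<Union>w\<in>W. cylinder w) \<in> sets borel" "(\<Union>w\<in>W. cylinder w) \<subseteq> irr_unit"
    using cylinder_subset by (auto intro!: sets.countable_UN' countable_words)
  have "emeasure lborel (\<Union>w\<in>W. F w) = (\<integral>\<^sup>+w. emeasure lborel (F w) \<partial>count_space W)"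
    by (rule emeasure_UN_countable) (use F disjF countable_words in auto)
  also have "\<dots> \<le> (\<integral>\<^sup>+w. ennreal k * emeasure lborel (cylinder w) \<partial>count_space W)"
  proof (rule nn_integral_mono)
    fix w assume "w \<in> space (count_space W)"
    then have w: "w \<in> W" by simp
    have "F w \<subseteq> irr_unit" using F(2)[OF w] cylinder_subset by blast
    then have "emeasure lborel (F w) = ennreal (lam (F w))" by (rule fin[OF F(1)[OF w]])
    also have "\<dots> \<le> ennreal (k * lam (cylinder w))" using F(3)[OF w] by (rule ennreal_leI)
    also have "\<dots> = ennreal k * emeasure lborel (cylinder w)"
      using k by (simp add: fin cylinder_subset ennreal_mult)
    finally show "emeasure lborel (F w) \<le> ennreal k * emeasure lborel (cylinder w)" .
  qed
  also have "\<dots> = ennreal k * (\<integral>\<^sup>+w. emeasure lborel (cylinder w) \<partial>count_space W)"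
    by (rule nn_integral_cmult) simp
  also have "(\<integral>\<^sup>+w. emeasure lborel (cylinder w) \<partial>count_space W) = emeasure lborel (\<Union>w\<in>W. cylinder w)"
    by (rule emeasure_UN_countable[symmetric]) (use disjC countable_words in auto)
  finally have "ennreal (lam (\<Union>w\<in>W. F w)) \<le> ennreal (k * lam (\<Union>w\<in>W. cylinder w))"
    using k by (simp add: fin[OF FW] fin[OF CW] ennreal_mult)
  then show ?thesis using k by (simp add: ennreal_le_iff)
qed

text \<open>Stands in for the invariance of the Gauss measure: each piece with prescribed first
  \<open>n\<close> digits is bounded by distortion. The constant does not depend on
  \<open>n\<close>.\<close>

lemma lam_gauss_map_preimage_le:
  assumes "E \<in> sets borel" "E \<subseteq> irr_unit"
  shows "lam {x \<in> irr_unit. (gauss_map ^^ n) x \<in> E} \<le> 4 * lam E"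
proof -
  define W where "W = {w \<in> words. length w = n}"
  have u: "(\<Union>w\<in>W. cylinder w) = irr_unit"
    using digits_in_words cylinder_subset by (fastforce simp: W_def cylinder_def)
  have "(\<Union>w\<in>W. branch w ` E) = (\<Union>w\<in>W. {x \<in> cylinder w. (gauss_map ^^ n) x \<in> E})"
    by (rule SUP_cong) (auto simp: W_def branch_image[OF _ assms(2)])
  also have "\<dots> = {x \<in> irr_unit. (gauss_map ^^ n) x \<in> E}"
    unfolding u[symmetric] by auto
  finally have v: "(\<Union>w\<in>W. branch w ` E) = {x \<in> irr_unit. (gauss_map ^^ n) x \<in> E}" .
  have "lam (\<Union>w\<in>W. branch w ` E) \<le> (4 * lam E) * lam (\<Union>w\<in>W. cylinder w)"
  proof (rule lam_UN_cylinder_le[where n = n])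
    fix w assume "w \<in> W"
    then have w: "w \<in> words" "length w = n" by (auto simp: W_def)
    show "branch w ` E \<in> sets borel" by (rule branch_image_borel[OF w(1) assms])
    show "branch w ` E \<subseteq> cylinder w" using branch_image[OF w(1) assms(2)] by auto
    show "lam (branch w ` E) \<le> 4 * lam E * lam (cylinder w)"
      using branch_distortion(1)[OF w(1) assms] by (simp add: mult_ac)
  qed (auto simp: W_def)
  then show ?thesis by (simp add: u v lam_irr_unit)
qed

lemma lam_mono: "A \<subseteq> B \<Longrightarrow> A \<in> sets borel \<Longrightarrow> B \<in> fmeasurable lborel \<Longrightarrow> lam A \<le> lam B"
  by (rule measure_mono_fmeasurable) auto

text \<open>A replacement for the Lebesgue density theorem: an open set is, up to a null set, the
  increasing union over \<open>n\<close> of the cylinders of length \<open>n\<close> that it contains.\<close>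

lemma null_if_small_on_cylinders:
  assumes B: "B \<in> sets borel" "B \<subseteq> irr_unit" and e: "0 < e" "e \<le> 1"
    and small: "\<And>w. w \<in> words \<Longrightarrow> lam (B \<inter> cylinder w) \<le> (1 - e) * lam (cylinder w)"
  shows "lam B = 0"
proof (rule ccontr)
  assume "lam B \<noteq> 0"
  then have pos: "0 < lam B" using measure_nonneg[of lborel B] by linarith
  \<comment> \<open>Half of \<open>e * lam B\<close>, so that \<open>(1 - e) * (lam B + r)\<close>
    stays below \<open>lam B\<close> in the final estimate.\<close>
  define r where "r = e * lam B / 2"
  have r: "0 < r" using e pos by (simp add: r_def)
  obtain U where U: "open U" "B \<subseteq> U" "emeasure lborel (U - B) \<le> ennreal r"
    using outer_regular_lborel_le[OF B(1) r] by blast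
  define W where "W n = {w \<in> words. length w = n \<and> cylinder w \<subseteq> U}" for n
  define V where "V n = (\<Union>w\<in>W n. cylinder w)" for n
  have Vb: "V n \<in> sets borel" for n
    unfolding V_def by (intro sets.countable_UN' countable_words) auto
  have VU: "V n \<subseteq> U \<inter> irr_unit" for n
    unfolding V_def W_def using cylinder_subset by auto
  have inV: "x \<in> V n \<longleftrightarrow> x \<in> irr_unit \<and> cylinder (digits n x) \<subseteq> U" for x n
    using digits_in_words[of x n] by (auto simp: V_def W_def cylinder_def)
  have "V n \<subseteq> V (Suc n)" for n
  proof
    fix x assume x: "x \<in> V n"
    have "cylinder (digits (Suc n) x) \<subseteq> cylinder (digits n x)"
    proof
      fix y assume "y \<in> cylinder (digits (Suc n) x)"
      then have "y \<in> irr_unit" "digits (n + 1) y = digits (n + 1) x" by (simp_all add: cylinder_def)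
      then have "digits n y = digits n x" unfolding digits_add by simp
      with \<open>y \<in> irr_unit\<close> show "y \<in> cylinder (digits n x)" by (simp add: cylinder_def)
    qed
    with x show "x \<in> V (Suc n)" unfolding inV by blast
  qed
  then have inc: "incseq (\<lambda>n. B \<inter> V n)" by (intro incseq_SucI) blast
  have "x \<in> (\<Union>n. V n)" if x: "x \<in> B" for x
  proof -
    obtain d where d: "0 < d" "ball x d \<subseteq> U" using U x by (meson openE subsetD)
    obtain n where n: "0 < n" "1 / real n < d" using d(1)
      by (metis nat_approx_posE zero_less_Suc)
    have xi: "x \<in> irr_unit" using x B by blast
    have xc: "x \<in> cylinder (digits n x)" using xi by (simp add: cylinder_def)
    have "cylinder (digits n x) \<subseteq> ball x d"
    proof
      fix y assume "y \<in> cylinder (digits n x)"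
      from cylinder_diameter[OF digits_in_words[OF xi] xc this] have "\<bar>x - y\<bar> \<le> 1 / real n"
        using n(1) by (metis length_digits less_not_refl list.size(3))
      then show "y \<in> ball x d" using n(2) by (simp add: dist_real_def)
    qed
    then show ?thesis using d xi by (auto simp: inV)
  qed
  then have un: "(\<Union>n. B \<inter> V n) = B" by blast
  have fm: "B \<inter> V n \<in> fmeasurable lborel" "V n \<in> fmeasurable lborel" "B \<in> fmeasurable lborel" for n
  proof -
    have "V n \<subseteq> irr_unit" using VU by blast
    with B Vb[of n] show "B \<inter> V n \<in> fmeasurable lborel" "V n \<in> fmeasurable lborel"
      "B \<in> fmeasurable lborel"
      by (auto intro!: lmeasurable_subset_irr_unit(2))
  qed
  have "(\<lambda>n. lam (B \<inter> V n)) \<longlonglongrightarrow> lam (\<Union>n. B \<inter> V n)"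
  proof (rule Lim_measure_incseq[OF _ inc])
    show "range (\<lambda>n. B \<inter> V n) \<subseteq> sets lborel" using B Vb by auto
    show "emeasure lborel (\<Union>n. B \<inter> V n) \<noteq> \<infinity>" unfolding un using fm(3) by (auto simp: fmeasurable_def)
  qed
  moreover have "lam (B \<inter> V n) \<le> (1 - e) * (lam B + r)" for n
  proof -
    have "lam (\<Union>w\<in>W n. B \<inter> cylinder w) \<le> (1 - e) * lam (\<Union>w\<in>W n. cylinder w)"
      by (rule lam_UN_cylinder_le[where n = n]) (use e B small in \<open>auto simp: W_def\<close>)
    then have 1: "lam (B \<inter> V n) \<le> (1 - e) * lam (V n)"
      by (simp add: V_def)
    have "emeasure lborel (V n - B) \<le> ennreal r"
      using U(1) B(1) VU[of n] by (intro order.trans[OF emeasure_mono U(3)]) auto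
    then have d: "lam (V n - B) \<le> r" using r by (simp add: measure_def enn2real_leI)
    have "V n - B \<in> fmeasurable lborel"
      using fm(2) B by (intro fmeasurable_Diff) auto
    then have "lam (V n) \<le> lam (B \<union> (V n - B))"
      using Vb fm(3) by (intro lam_mono fmeasurable.Un) auto
    also have "\<dots> \<le> lam B + lam (V n - B)"
      using B Vb by (intro measure_Un_le) auto
    finally have "lam (V n) \<le> lam B + r" using d by simp
    then show ?thesis using 1 e by (meson diff_ge_0_iff_ge mult_left_mono order_trans)
  qed
  ultimately have "lam B \<le> (1 - e) * (lam B + r)"
    unfolding un by (blast intro: LIMSEQ_le_const2)
  also have "\<dots> = lam B - e * lam B + r - e * r" by (simp add: algebra_simps)
  also have "\<dots> < lam B" using mult_pos_pos[OF e(1) r] mult_pos_pos[OF e(1) pos] by (simp add: r_def)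
  finally show False by simp
qed

text \<open>The data of a skew product over the Gauss map with finite fibre \<open>S\<close>: the
  first digit of the base point moves the fibre. Transitivity is by forward words only.\<close>

locale digit_action =
  fixes S :: "'s set" and act :: "nat \<Rightarrow> 's \<Rightarrow> 's"
  assumes finite_S: "finite S"
    and act_bij: "0 < d \<Longrightarrow> bij_betw (act d) S S"
    and transitive: "\<sigma> \<in> S \<Longrightarrow> \<tau> \<in> S \<Longrightarrow> \<exists>w\<in>words. foldl (\<lambda>s d. act d s) \<sigma> w = \<tau>"
begin

section \<open>Visit counts and overvisited sets\<close>

abbreviation run :: "'s \<Rightarrow> nat list \<Rightarrow> 's" where
  "run \<equiv> foldl (\<lambda>s d. act d s)"

definition state :: "nat \<Rightarrow> real \<Rightarrow> 's \<Rightarrow> 's" where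
  "state n x \<sigma> = run \<sigma> (digits n x)"

definition visits :: "'s \<Rightarrow> 's \<Rightarrow> nat \<Rightarrow> real \<Rightarrow> nat" where
  "visits t \<sigma> N x = card {n. n < N \<and> state n x \<sigma> = t}"

text \<open>An additive excess is used instead of an upper limit, so that both sides are directly
  usable: off the set, \<open>visits\<close> is at most \<open>c * N + K\<close> for some
  \<open>K\<close>; on the set, \<open>K = 0\<close> already gives a time at which
  \<open>visits\<close> exceeds \<open>c * N\<close>.\<close>

definition overvisited :: "real \<Rightarrow> 's \<Rightarrow> 's \<Rightarrow> real set" where
  "overvisited c t \<sigma> = {x \<in> irr_unit. \<forall>K::nat. \<exists>N. c * real N + real K < real (visits t \<sigma> N x)}"

lemma state_add: "state (m + n) x \<sigma> = state n ((gauss_map ^^ m) x) (state m x \<sigma>)"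
  by (simp add: state_def digits_add)

lemma visits_add:
  "visits t \<sigma> (m + n) x = visits t \<sigma> m x + visits t (state m x \<sigma>) n ((gauss_map ^^ m) x)"
proof -
  have "{k. k < m + n \<and> state k x \<sigma> = t} =
      {k. k < m \<and> state k x \<sigma> = t} \<union>
      (+) m ` {k. k < n \<and> state k ((gauss_map ^^ m) x) (state m x \<sigma>) = t}" (is "?A = ?B \<union> (+) m ` ?C")
  proof (intro equalityI subsetI)
    fix k assume k: "k \<in> ?A"
    show "k \<in> ?B \<union> (+) m ` ?C"
    proof (cases "k < m")
      case False
      then have "k = m + (k - m)" by simp
      with k False show ?thesis
        by (metis (mono_tags, lifting) UnI2 image_eqI mem_Collect_eq nat_add_left_cancel_less state_add)
    qed (use k in auto)
  qed (auto simp: state_add)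
  moreover have "card (?B \<union> (+) m ` ?C) = card ?B + card ((+) m ` ?C)"
    by (rule card_Un_disjoint) auto
  moreover have "card ((+) m ` ?C) = card ?C" by (rule card_image) auto
  ultimately show ?thesis by (simp add: visits_def)
qed

lemma visits_le: "visits t \<sigma> N x \<le> N"
proof -
  have "visits t \<sigma> N x \<le> card {..<N}" unfolding visits_def by (rule card_mono) auto
  then show ?thesis by simp
qed

lemma run_bij: "w \<in> words \<Longrightarrow> bij_betw (\<lambda>\<sigma>. run \<sigma> w) S S"
proof (induction w)
  case Nil
  show ?case by (simp add: bij_betw_def)
next
  case (Cons d w)
  then have "bij_betw ((\<lambda>\<sigma>. run \<sigma> w) \<circ> act d) S S"
    by (intro bij_betw_trans[OF act_bij]) auto
  then show ?case by (simp add: comp_def)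
qed

lemma run_in: "w \<in> words \<Longrightarrow> \<sigma> \<in> S \<Longrightarrow> run \<sigma> w \<in> S"
  by (rule bij_betw_apply[OF run_bij])

lemma state_bij: "x \<in> irr_unit \<Longrightarrow> bij_betw (state n x) S S"
  unfolding state_def[abs_def] by (rule run_bij[OF digits_in_words])

lemma state_in: "x \<in> irr_unit \<Longrightarrow> \<sigma> \<in> S \<Longrightarrow> state n x \<sigma> \<in> S"
  by (rule bij_betw_apply[OF state_bij])

text \<open>At each time exactly one start is carried to \<open>t\<close>, since
  \<open>state n x\<close> permutes \<open>S\<close>. The identity is pointwise, with no exceptional
  null set.\<close>

lemma sum_visits_start:
  assumes "x \<in> irr_unit" "t \<in> S"
  shows "(\<Sum>\<sigma>\<in>S. visits t \<sigma> N x) = N"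
proof -
  have "(\<Sum>\<sigma>\<in>S. visits t \<sigma> N x) = (\<Sum>\<sigma>\<in>S. \<Sum>n<N. if state n x \<sigma> = t then 1 else 0)"
    by (simp add: visits_def sum.If_cases Int_def)
  also have "\<dots> = (\<Sum>n<N. \<Sum>\<sigma>\<in>S. if state n x \<sigma> = t then 1 else 0)"
    by (rule sum.swap)
  also have "\<dots> = (\<Sum>n<N. 1)"
  proof (rule sum.cong[OF refl])
    fix n
    have "(\<Sum>\<sigma>\<in>S. if state n x \<sigma> = t then 1 else 0) = (\<Sum>\<tau>\<in>S. if \<tau> = t then 1 else (0::nat))"
      by (rule sum.reindex_bij_betw[OF state_bij[OF assms(1)]])
    also have "\<dots> = 1" using assms finite_S by simp
    finally show "(\<Sum>\<sigma>\<in>S. if state n x \<sigma> = t then 1 else 0) = (1::nat)" .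
  qed
  finally show ?thesis by simp
qed

text \<open>Here the target varies for one fixed start. It turns upper bounds for all other states
  into a lower bound for one state.\<close>

lemma sum_visits_end:
  assumes "x \<in> irr_unit" "\<sigma> \<in> S"
  shows "(\<Sum>t\<in>S. visits t \<sigma> N x) = N"
proof -
  have "(\<Sum>t\<in>S. visits t \<sigma> N x) = (\<Sum>t\<in>S. \<Sum>n<N. if state n x \<sigma> = t then 1 else 0)"
    by (simp add: visits_def sum.If_cases Int_def)
  also have "\<dots> = (\<Sum>n<N. \<Sum>t\<in>S. if state n x \<sigma> = t then 1 else 0)"
    by (rule sum.swap)
  also have "\<dots> = N" using finite_S state_in[OF assms] by simp
  finally show ?thesis .
qed

lemma state_borel: "{x \<in> irr_unit. state n x \<sigma> = t} \<in> sets borel"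
proof -
  have "{x \<in> irr_unit. state n x \<sigma> = t} = (\<Union>w\<in>{w. length w = n \<and> run \<sigma> w = t}. cylinder w)"
    by (auto simp: state_def cylinder_def)
  also have "\<dots> \<in> sets borel"
    by (intro sets.countable_UN' countable_words) auto
  finally show ?thesis .
qed

lemma visits_borel:
  "{x \<in> irr_unit. P (visits t \<sigma> N x)} \<in> sets borel"
proof -
  have "(\<lambda>x. visits t \<sigma> N x) \<in> measurable (restrict_space borel irr_unit) (count_space UNIV)"
  proof -
    have [measurable]: "Measurable.pred (restrict_space borel irr_unit) (\<lambda>x. state n x \<sigma> = t)" for n
    proof -
      have "{x \<in> space (restrict_space borel irr_unit). state n x \<sigma> = t} = {x \<in> irr_unit. state n x \<sigma> = t}"
        by (simp add: space_restrict_space)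
      also have "\<dots> \<in> sets (restrict_space borel irr_unit)"
        using state_borel by (subst sets_restrict_space_iff) auto
      finally show ?thesis by (simp add: pred_def)
    qed
    show ?thesis unfolding visits_def by measurable
  qed
  then have "(\<lambda>x. visits t \<sigma> N x) -` {k. P k} \<inter> space (restrict_space borel irr_unit)
      \<in> sets (restrict_space borel irr_unit)"
    by (rule measurable_sets) simp
  moreover have "(\<lambda>x. visits t \<sigma> N x) -` {k. P k} \<inter> space (restrict_space borel irr_unit) =
      {x \<in> irr_unit. P (visits t \<sigma> N x)}"
    by (auto simp: space_restrict_space)
  ultimately show ?thesis by (simp add: sets_restrict_space_iff)
qed

lemma overvisited_borel: "overvisited c t \<sigma> \<in> sets borel"
proof -
  have "overvisited c t \<sigma> = (\<Inter>K::nat. \<Union>N. {x \<in> irr_unit. c * real N + real K < real (visits t \<sigma> N x)})"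
    by (auto simp: overvisited_def)
  also have "\<dots> \<in> sets borel"
    by (intro sets.countable_INT'' sets.countable_UN) (auto intro: visits_borel)
  finally show ?thesis .
qed

lemma overvisited_subset: "overvisited c t \<sigma> \<subseteq> irr_unit"
  by (auto simp: overvisited_def)

text \<open>Dropping \<open>m\<close> digits changes both sides of the inequality by a bounded
  amount, which the quantifier over \<open>K\<close> absorbs.\<close>

lemma overvisited_shift:
  assumes x: "x \<in> irr_unit" and c: "0 \<le> c"
  shows "x \<in> overvisited c t \<sigma> \<longleftrightarrow> (gauss_map ^^ m) x \<in> overvisited c t (state m x \<sigma>)"
proof
  assume L: "x \<in> overvisited c t \<sigma>"
  have "\<exists>N. c * real N + real K < real (visits t (state m x \<sigma>) N ((gauss_map ^^ m) x))" for K :: nat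
  proof -
    obtain N where N: "c * real N + real (K + m) < real (visits t \<sigma> N x)"
      using L unfolding overvisited_def by blast
    have c0: "0 \<le> c * real N" using c by simp
    \<comment> \<open>\<open>visits\<close> never exceeds \<open>N\<close>, and here it is greater
      than \<open>m\<close>.\<close>
    have "m \<le> N" using N c0 visits_le[of t \<sigma> N x] by linarith
    then obtain k where k: "N = m + k" using le_Suc_ex by blast
    have "c * real k \<le> c * real N" using c k by (intro mult_left_mono) auto
    then have "c * real k + real K < real (visits t (state m x \<sigma>) k ((gauss_map ^^ m) x))"
      using N visits_le[of t \<sigma> m x] unfolding k visits_add by linarith
    then show ?thesis by blast
  qed
  then show "(gauss_map ^^ m) x \<in> overvisited c t (state m x \<sigma>)"
    using gauss_map_iter_in_irr_unit[OF x] by (auto simp: overvisited_def)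
next
  assume R: "(gauss_map ^^ m) x \<in> overvisited c t (state m x \<sigma>)"
  have "\<exists>N. c * real N + real K < real (visits t \<sigma> N x)" for K :: nat
  proof -
    obtain K' where K': "real K + c * real m \<le> real K'" using real_arch_simple by blast
    obtain N where "c * real N + real K' < real (visits t (state m x \<sigma>) N ((gauss_map ^^ m) x))"
      using R unfolding overvisited_def by blast
    then have "c * real (m + N) + real K < real (visits t \<sigma> (m + N) x)"
      using K' unfolding visits_add of_nat_add distrib_left by linarith
    then show ?thesis by blast
  qed
  then show "x \<in> overvisited c t \<sigma>" using x by (auto simp: overvisited_def)
qed

text \<open>Inside a cylinder the complement for \<open>\<sigma>\<close> is a copy of the one for
  \<open>run \<sigma> w\<close>, which makes it accessible to distortion.\<close>

lemma overvisited_on_cylinder: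
  assumes w: "w \<in> words" and c: "0 \<le> c"
  shows "cylinder w - overvisited c t \<sigma> = branch w ` (irr_unit - overvisited c t (run \<sigma> w))"
proof -
  have "x \<in> overvisited c t \<sigma> \<longleftrightarrow> (gauss_map ^^ length w) x \<in> overvisited c t (run \<sigma> w)"
    if "x \<in> cylinder w" for x
    using overvisited_shift[of x c t \<sigma> "length w"] that c by (auto simp: cylinder_def state_def)
  then show ?thesis
    unfolding branch_image[OF w Diff_subset]
    by (auto simp: cylinder_def gauss_map_iter_in_irr_unit)
qed

text \<open>One null complement forces all to be null: along a word leading from its state to
  \<open>\<sigma>\<close>, the complement for \<open>\<sigma>\<close> is copied into a null set. If
  none is null, the overvisited set misses a fixed proportion of every cylinder, and
  \<open>null_if_small_on_cylinders\<close> applies.\<close>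

lemma overvisited_zero_one:
  assumes c: "0 \<le> c"
  shows "(\<forall>\<sigma>\<in>S. lam (overvisited c t \<sigma>) = 0) \<or> (\<forall>\<sigma>\<in>S. lam (irr_unit - overvisited c t \<sigma>) = 0)"
proof (cases "\<exists>\<tau>\<in>S. lam (irr_unit - overvisited c t \<tau>) = 0")
  case True
  then obtain \<tau> where \<tau>: "\<tau> \<in> S" "lam (irr_unit - overvisited c t \<tau>) = 0" by blast
  have "lam (irr_unit - overvisited c t \<sigma>) = 0" if \<sigma>: "\<sigma> \<in> S" for \<sigma>
  proof -
    obtain w where w: "w \<in> words" "run \<tau> w = \<sigma>" using transitive[OF \<tau>(1) \<sigma>] by blast
    have b: "irr_unit - overvisited c t \<sigma> \<in> sets borel" for \<sigma>
      using overvisited_borel by auto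
    have "lam (branch w ` (irr_unit - overvisited c t \<sigma>)) \<le> lam (irr_unit - overvisited c t \<tau>)"
      using overvisited_on_cylinder[OF w(1) c, of t \<tau>] b[of \<tau>] cylinder_subset
        branch_image_borel[OF w(1) b[of \<sigma>]] w(2)
      by (intro lam_mono lmeasurable_subset_irr_unit) auto
    then have "lam (cylinder w) * lam (irr_unit - overvisited c t \<sigma>) \<le> 0"
      using branch_distortion(2)[OF w(1) b[of \<sigma>]] \<tau>(2) by auto
    then show ?thesis
      using branch_distortion(3)[OF w(1) b[of \<sigma>]]
      by (auto simp: mult_le_0_iff measure_le_0_iff)
  qed
  then show ?thesis by blast
next
  case False
  show ?thesis
  proof (cases "S = {}")
    case False
    \<comment> \<open>Positive because \<open>S\<close> is finite; distortion lowers the proportion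
      to \<open>m / 4\<close> in each cylinder.\<close>
    define m where "m = Min ((\<lambda>\<tau>. lam (irr_unit - overvisited c t \<tau>)) ` S)"
    have b: "irr_unit - overvisited c t \<sigma> \<in> sets borel" for \<sigma>
      using overvisited_borel by auto
    have le1: "lam (irr_unit - overvisited c t \<tau>) \<le> 1" for \<tau>
      using b[of \<tau>] lam_irr_unit
      by (metis Diff_subset irr_unit_borel lam_mono lmeasurable_subset_irr_unit(2) order_refl)
    have m: "m \<le> lam (irr_unit - overvisited c t \<tau>)" if "\<tau> \<in> S" for \<tau>
      using that finite_S by (simp add: m_def)
    have "m \<in> (\<lambda>\<tau>. lam (irr_unit - overvisited c t \<tau>)) ` S"
      unfolding m_def using finite_S False by (intro Min_in) auto
    then have "m \<noteq> 0" "0 \<le> m" "m \<le> 1" using \<open>\<not> (\<exists>\<tau>\<in>S. _ \<tau>)\<close> le1 by auto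
    then have m01: "0 < m" "m \<le> 1" by auto
    have "lam (overvisited c t \<sigma>) = 0" if \<sigma>: "\<sigma> \<in> S" for \<sigma>
    proof (rule null_if_small_on_cylinders[OF overvisited_borel overvisited_subset])
      show "0 < m / 4" "m / 4 \<le> 1" using m01 by auto
      fix w :: "nat list" assume w: "w \<in> words"
      have "lam (cylinder w) * m \<le> lam (cylinder w) * lam (irr_unit - overvisited c t (run \<sigma> w))"
        by (intro mult_left_mono m run_in[OF w \<sigma>]) auto
      also have "\<dots> \<le> 4 * lam (cylinder w - overvisited c t \<sigma>)"
        unfolding overvisited_on_cylinder[OF w c] by (rule branch_distortion(2)[OF w b]) auto
      also have "lam (cylinder w - overvisited c t \<sigma>) =
          lam (cylinder w) - lam (overvisited c t \<sigma> \<inter> cylinder w)"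
      proof -
        have "lam (cylinder w - cylinder w \<inter> overvisited c t \<sigma>) =
            lam (cylinder w) - lam (cylinder w \<inter> overvisited c t \<sigma>)"
          by (rule measurable_measure_Diff)
            (use overvisited_borel cylinder_subset[of w] in \<open>auto intro!: lmeasurable_subset_irr_unit(2)\<close>)
        then show ?thesis by (simp add: Diff_Int Int_commute)
      qed
      finally show "lam (overvisited c t \<sigma> \<inter> cylinder w) \<le> (1 - m / 4) * lam (cylinder w)"
        by (simp add: algebra_simps)
    qed
    then show ?thesis by blast
  qed auto
qed

text \<open>The orbit is cut greedily. Outside \<open>E\<close> a block of length at most
  \<open>M\<close> with frequency at least \<open>c\<close> is cut off; in \<open>E\<close> a single
  step, whose loss is paid for by the indicator. A last piece of length at most \<open>M\<close> is
  given up. The state changes from block to block, so \<open>E\<close> must serve all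
  states.\<close>

lemma visits_lower_bound:
  assumes c: "0 \<le> c"
    and E: "\<And>x \<sigma>. x \<in> irr_unit \<Longrightarrow> \<sigma> \<in> S \<Longrightarrow> x \<notin> E \<Longrightarrow>
      \<exists>n. 1 \<le> n \<and> n \<le> M \<and> c * real n \<le> real (visits t \<sigma> n x)"
  shows "x \<in> irr_unit \<Longrightarrow> \<sigma> \<in> S \<Longrightarrow>
    c * (real N - real M - (\<Sum>n<N. indicator E ((gauss_map ^^ n) x))) \<le> real (visits t \<sigma> N x)"
proof (induction N arbitrary: x \<sigma> rule: less_induct)
  case (less N)
  let ?B = "\<lambda>N x. (\<Sum>n<N. indicator E ((gauss_map ^^ n) x)) :: real"
  have step: "c * (real N - real M - ?B N x) \<le> real (visits t \<sigma> N x)"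
    if m: "1 \<le> m" "m \<le> N" "c * (real m - ?B m x) \<le> real (visits t \<sigma> m x)" for m
  proof -
    define k where "k = N - m"
    have N: "N = m + k" "k < N" using m by (auto simp: k_def)
    have sp: "?B N x = ?B m x + ?B k ((gauss_map ^^ m) x)"
    proof -
      have "?B (m + k) x = ?B m x + (\<Sum>n<k. indicator E ((gauss_map ^^ (n + m)) x))"
        by (induction k) (simp_all add: add_ac)
      then show ?thesis by (simp add: N(1) funpow_add)
    qed
    have "c * (real k - real M - ?B k ((gauss_map ^^ m) x)) \<le>
        real (visits t (state m x \<sigma>) k ((gauss_map ^^ m) x))"
      by (rule less.IH[OF N(2)]) (use less.prems state_in gauss_map_iter_in_irr_unit in auto)
    then have "c * (real m - ?B m x) + c * (real k - real M - ?B k ((gauss_map ^^ m) x)) \<le>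
        real (visits t \<sigma> N x)"
      using m(3) unfolding N(1) visits_add by simp
    then show ?thesis unfolding sp by (simp add: N(1) algebra_simps)
  qed
  have B0: "0 \<le> ?B n x" for n by (intro sum_nonneg) auto
  show ?case
  proof (cases "N \<le> M")
    case True
    then have "c * (real N - real M - ?B N x) \<le> 0"
      using B0[of N] c by (intro mult_nonneg_nonpos) auto
    then show ?thesis by (rule order_trans) simp
  next
    case False
    show ?thesis
    proof (cases "x \<in> E")
      case True
      show ?thesis by (rule step[of 1]) (use False True in auto)
    next
      case xE: False
      obtain n where n: "1 \<le> n" "n \<le> M" "c * real n \<le> real (visits t \<sigma> n x)"
        using E[OF less.prems xE] by blast
      have "c * (real n - ?B n x) \<le> c * real n"
        using c B0[of n] by (intro mult_left_mono) auto
      with n False show ?thesis by (intro step[of n]) auto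
    qed
  qed
qed

text \<open>If all complements were null, then outside a set \<open>E\<close> of measure below
  \<open>r\<close> every start would have a good time at most \<open>M\<close>. Adding the lower
  bounds over the starts and integrating gives \<open>N - M - N / q \<le> 4 * r * N\<close> for
  every \<open>N\<close>, which fails for large \<open>N\<close>.\<close>

lemma lam_not_overvisited_pos:
  assumes t: "t \<in> S" and c: "1 < c * real (card S)"
  shows "\<exists>\<sigma>\<in>S. lam (irr_unit - overvisited c t \<sigma>) \<noteq> 0"
proof (rule ccontr)
  assume "\<not> ?thesis"
  then have full: "lam (irr_unit - overvisited c t \<sigma>) = 0" if "\<sigma> \<in> S" for \<sigma> using that by blast
  have cardS: "0 < card S" using t finite_S by (auto simp: card_gt_0_iff)
  define q where "q = c * real (card S)"
  have c0: "0 \<le> c"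
  proof (rule ccontr)
    assume "\<not> 0 \<le> c"
    then have "c * real (card S) \<le> 0" by (intro mult_nonpos_nonneg) auto
    with c show False by simp
  qed
  have q: "1 < q" using c by (simp add: q_def)
  \<comment> \<open>The points without a good time up to \<open>M\<close>. Good times are at least
    1, so that blocks are nonempty.\<close>
  define F where "F M \<sigma> = {x \<in> irr_unit. \<forall>n. 1 \<le> n \<and> n \<le> M \<longrightarrow> \<not> c * real n \<le> real (visits t \<sigma> n x)}"
    for M \<sigma>
  have Fb: "F M \<sigma> \<in> sets borel" for M \<sigma>
  proof -
    have "F M \<sigma> = irr_unit \<inter> (\<Inter>n\<in>{1..M}. irr_unit - {x \<in> irr_unit. c * real n \<le> real (visits t \<sigma> n x)})"
      by (auto simp: F_def)
    also have "\<dots> \<in> sets borel"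
    proof (cases "{1..M} = {}")
      case False
      then show ?thesis
        by (intro sets.Int sets.finite_INT sets.Diff visits_borel irr_unit_borel) auto
    next
      case True
      show ?thesis unfolding True by simp
    qed
    finally show ?thesis .
  qed
  have Fs: "F M \<sigma> \<subseteq> irr_unit" for M \<sigma> by (auto simp: F_def)
  have F0: "(\<lambda>M. lam (F M \<sigma>)) \<longlonglongrightarrow> 0" if \<sigma>: "\<sigma> \<in> S" for \<sigma>
  proof -
    have dec: "decseq (\<lambda>M. F M \<sigma>)" by (auto simp: decseq_def F_def)
    have "(\<lambda>M. lam (F M \<sigma>)) \<longlonglongrightarrow> lam (\<Inter>M. F M \<sigma>)"
    proof (rule Lim_measure_decseq[OF _ dec])
      show "emeasure lborel (F M \<sigma>) \<noteq> \<infinity>" for M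
        using lmeasurable_subset_irr_unit(2)[OF Fb Fs] by (simp add: fmeasurable_def less_top)
    qed (use Fb in auto)
    \<comment> \<open>Having no good time at all contradicts the case \<open>K = 0\<close> of
      \<open>overvisited\<close>.\<close>
    moreover have "(\<Inter>M. F M \<sigma>) \<subseteq> irr_unit - overvisited c t \<sigma>"
    proof
      fix x assume x: "x \<in> (\<Inter>M. F M \<sigma>)"
      have "\<not> (c * real N + real 0 < real (visits t \<sigma> N x))" for N
      proof (cases "N = 0")
        case True
        then show ?thesis by (simp add: visits_def)
      next
        case False
        have "x \<in> F N \<sigma>" using x by blast
        then have "\<not> c * real N \<le> real (visits t \<sigma> N x)" using False by (simp add: F_def)
        then show ?thesis by simp
      qed
      then have "\<not> (\<forall>K::nat. \<exists>N. c * real N + real K < real (visits t \<sigma> N x))" by blast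
      then have "x \<notin> overvisited c t \<sigma>" by (simp add: overvisited_def)
      then show "x \<in> irr_unit - overvisited c t \<sigma>" using x Fs by blast
    qed
    then have "lam (\<Inter>M. F M \<sigma>) \<le> lam (irr_unit - overvisited c t \<sigma>)"
      using Fb overvisited_borel
      by (intro lam_mono lmeasurable_subset_irr_unit(2)) auto
    then have "lam (\<Inter>M. F M \<sigma>) = 0" using full[OF \<sigma>] by (simp add: measure_le_0_iff)
    ultimately show ?thesis by simp
  qed
  have "(\<lambda>M. \<Sum>\<sigma>\<in>S. lam (F M \<sigma>)) \<longlonglongrightarrow> (\<Sum>\<sigma>\<in>S. 0)"
    by (intro tendsto_sum F0)
  \<comment> \<open>The 8 is twice the distortion factor: \<open>4 * r\<close> is half of
    \<open>1 - 1 / q\<close>, which leaves room to absorb \<open>M\<close>.\<close>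
  moreover define r where "r = (1 - 1 / q) / 8"
  moreover have r: "0 < r" using q by (simp add: r_def)
  ultimately have "eventually (\<lambda>M. (\<Sum>\<sigma>\<in>S. lam (F M \<sigma>)) < r) sequentially"
    by (intro order_tendstoD(2)) auto
  then obtain M where M: "(\<Sum>\<sigma>\<in>S. lam (F M \<sigma>)) < r"
    using eventually_happens trivial_limit_sequentially by blast
  \<comment> \<open>A union over all starts, since the state at the beginning of a block is not
    known in advance.\<close>
  define E where "E = (\<Union>\<sigma>\<in>S. F M \<sigma>)"
  have Eb: "E \<in> sets borel" "E \<subseteq> irr_unit"
    unfolding E_def using finite_S Fb by (intro sets.finite_UN UN_least Fs; simp)+
  have "lam E \<le> (\<Sum>\<sigma>\<in>S. lam (F M \<sigma>))"
    unfolding E_def using finite_S Fb by (intro measure_UNION_le) auto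
  then have Er: "lam E < r" using M by simp
  define A where "A n = {x \<in> irr_unit. (gauss_map ^^ n) x \<in> E}" for n
  have Ab: "A n \<in> sets borel" "A n \<subseteq> irr_unit" for n
  proof -
    have "A n = irr_unit \<inter> ((gauss_map ^^ n) -` E \<inter> space borel)" by (auto simp: A_def)
    then show "A n \<in> sets borel"
      using measurable_sets[OF borel_measurable_gauss_map_iter Eb(1)] by auto
  qed (auto simp: A_def)
  have Afin: "A n \<in> fmeasurable lborel" for n by (rule lmeasurable_subset_irr_unit(2)[OF Ab])
  have ifin: "irr_unit \<in> fmeasurable lborel" by (rule lmeasurable_subset_irr_unit(2)) auto
  \<comment> \<open>The indicator of \<open>irr_unit\<close> extends the pointwise bound to all
    reals, ready for integration.\<close>
  have pt: "(real N - real M - real N / q) * indicator irr_unit x \<le> (\<Sum>n<N. indicator (A n) x)" for N and x :: real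
  proof (cases "x \<in> irr_unit")
    case x: True
    let ?B = "\<Sum>n<N. indicator E ((gauss_map ^^ n) x) :: real"
    have "c * (real N - real M - ?B) \<le> real (visits t \<sigma> N x)" if "\<sigma> \<in> S" for \<sigma>
    proof (rule visits_lower_bound[OF c0 _ x that])
      fix y \<tau> assume "y \<in> irr_unit" "\<tau> \<in> S" "y \<notin> E"
      then show "\<exists>n. 1 \<le> n \<and> n \<le> M \<and> c * real n \<le> real (visits t \<tau> n y)"
        by (auto simp: E_def F_def)
    qed
    then have "(\<Sum>\<sigma>\<in>S. c * (real N - real M - ?B)) \<le> (\<Sum>\<sigma>\<in>S. real (visits t \<sigma> N x))"
      by (rule sum_mono)
    also have "\<dots> = real N" using sum_visits_start[OF x t, of N] by (metis of_nat_sum)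
    finally have "q * (real N - real M - ?B) \<le> real N" by (simp add: q_def mult_ac)
    then have "real N - real M - ?B \<le> real N / q" using q by (simp add: pos_le_divide_eq mult.commute)
    moreover have "?B = (\<Sum>n<N. indicator (A n) x)"
      using x by (intro sum.cong) (auto simp: A_def indicator_def)
    ultimately show ?thesis using x by simp
  qed (auto intro!: sum_nonneg)
  have main: "real N - real M - real N / q \<le> real N * (4 * r)" for N
  proof -
    have "(\<integral>x. (real N - real M - real N / q) * indicator irr_unit x \<partial>lborel) \<le>
        (\<integral>x. (\<Sum>n<N. indicator (A n) x) \<partial>lborel)"
      using Afin ifin
      by (intro integral_mono pt) (auto intro!: integrable_sum simp: fmeasurable_def)
    also have "(\<integral>x. (\<Sum>n<N. indicator (A n) x) \<partial>lborel) = (\<Sum>n<N. lam (A n))"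
      using Afin by (subst Bochner_Integration.integral_sum) (auto simp: fmeasurable_def)
    also have "\<dots> \<le> (\<Sum>n<N. 4 * r)"
    proof (rule sum_mono)
      fix n
      have "lam (A n) \<le> 4 * lam E"
        unfolding A_def by (rule lam_gauss_map_preimage_le[OF Eb])
      then show "lam (A n) \<le> 4 * r" using Er by simp
    qed
    finally show ?thesis by (simp add: lam_irr_unit)
  qed
  have "8 * r = 1 - 1 / q" by (simp add: r_def)
  then have k: "1 - 1 / q - 4 * r = 4 * r" by linarith
  obtain N :: nat where N: "real M / (4 * r) < real N" using reals_Archimedean2 by blast
  have "real N * (1 - 1 / q - 4 * r) \<le> real M"
    using main[of N] by (simp add: algebra_simps)
  then have "real N * (4 * r) \<le> real M" unfolding k .
  moreover have "real M < real N * (4 * r)" using N r by (simp add: pos_divide_less_eq)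
  ultimately show False by simp
qed

lemma overvisited_null:
  assumes "t \<in> S" "\<sigma> \<in> S" "1 < c * real (card S)"
  shows "overvisited c t \<sigma> \<in> null_sets lborel"
proof -
  have c0: "0 \<le> c"
  proof (rule ccontr)
    assume "\<not> 0 \<le> c"
    then have "c * real (card S) \<le> 0" by (intro mult_nonpos_nonneg) auto
    with assms show False by simp
  qed
  have "lam (overvisited c t \<sigma>) = 0"
    using overvisited_zero_one[OF c0, of t] lam_not_overvisited_pos[OF assms(1,3)] assms(2) by blast
  then show ?thesis
    using lmeasurable_subset_irr_unit(2)[OF overvisited_borel overvisited_subset]
    by (auto simp: null_sets_def emeasure_eq_measure2 overvisited_borel)
qed

theorem visit_frequency:
  assumes "t \<in> S" "\<sigma> \<in> S"
  shows "AE x in lborel. x \<in> irr_unit \<longrightarrow>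
    (\<lambda>N. real (visits t \<sigma> N x) / real N) \<longlonglongrightarrow> 1 / real (card S)"
proof -
  define s where "s = real (card S)"
  have s: "1 \<le> s" using assms finite_S by (auto simp: s_def Suc_le_eq card_gt_0_iff)
  \<comment> \<open>Countably many levels decreasing to \<open>1 / s\<close>, so that one null set
    serves them all.\<close>
  define c where "c k = 1 / s + 1 / real (Suc k)" for k
  have "1 < c k * real (card S)" for k
  proof -
    have "c k * s = 1 + s / real (Suc k)" using s by (simp add: c_def distrib_right)
    moreover have "0 < s / real (Suc k)" using s by simp
    ultimately show ?thesis by (simp add: s_def)
  qed
  then have "AE x in lborel. x \<notin> overvisited (c k) t' \<sigma>" if "t' \<in> S" for k t'
    using overvisited_null[OF that assms(2)] by (blast intro: AE_not_in)
  then have "AE x in lborel. \<forall>t'\<in>S. \<forall>k. x \<notin> overvisited (c k) t' \<sigma>"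
    using finite_S by (intro AE_finite_allI) (auto simp: AE_all_countable)
  then show ?thesis
  proof (rule AE_mp, intro AE_I2 impI)
    fix x assume x: "x \<in> irr_unit" and no: "\<forall>t'\<in>S. \<forall>k. x \<notin> overvisited (c k) t' \<sigma>"
    let ?a = "\<lambda>t' N. real (visits t' \<sigma> N x) / real N"
    have up: "\<forall>\<^sub>F N in sequentially. ?a t' N < 1 / s + e" if t': "t' \<in> S" and e: "0 < e" for t' e
    proof -
      obtain k where k: "1 / real (Suc k) < e / 2" using e by (meson half_gt_zero nat_approx_posE)
      obtain K :: nat where K: "\<And>N. real (visits t' \<sigma> N x) \<le> c k * real N + real K"
      proof -
        have "x \<notin> overvisited (c k) t' \<sigma>" using no t' by blast
        then have "\<exists>K::nat. \<forall>N. real (visits t' \<sigma> N x) \<le> c k * real N + real K"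
          using x by (simp add: overvisited_def not_less)
        then show thesis using that by blast
      qed
      have "(\<lambda>N. real K / real N) \<longlonglongrightarrow> 0" by (rule lim_const_over_n)
      then have "\<forall>\<^sub>F N in sequentially. real K / real N < e / 2"
        using e by (intro order_tendstoD(2)) auto
      then show ?thesis
        using eventually_gt_at_top[of 0]
      proof eventually_elim
        case (elim N)
        have "?a t' N \<le> (c k * real N + real K) / real N"
          using K by (intro divide_right_mono) auto
        also have "\<dots> = c k + real K / real N" using elim by (simp add: add_divide_distrib)
        also have "\<dots> < 1 / s + e" using elim k unfolding c_def by linarith
        finally show ?case .
      qed
    qed
    show "?a t \<longlonglongrightarrow> 1 / real (card S)"
      unfolding s_def[symmetric]
    proof (rule order_tendstoI)
      fix a assume "a < 1 / s"
      \<comment> \<open>Chosen so that the other \<open>s - 1\<close> states together take at most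
        \<open>1 - a - e\<close>, which leaves at least \<open>a + e\<close> for
        \<open>t\<close>.\<close>
      define e where "e = (1 / s - a) / s"
      have e: "0 < e" using \<open>a < 1 / s\<close> s by (simp add: e_def)
      have "\<forall>\<^sub>F N in sequentially. \<forall>t'\<in>S. ?a t' N < 1 / s + e"
        using finite_S up e by (intro eventually_ball_finite) auto
      then show "\<forall>\<^sub>F N in sequentially. a < ?a t N"
        using eventually_gt_at_top[of 0]
      proof eventually_elim
        case (elim N)
        have "(\<Sum>t'\<in>S. ?a t' N) = 1"
          using elim sum_visits_end[OF x assms(2), of N]
          by (metis (no_types) div_self of_nat_sum of_nat_0_less_iff less_irrefl sum_divide_distrib)
        moreover have "(\<Sum>t'\<in>S. ?a t' N) = ?a t N + (\<Sum>t'\<in>S - {t}. ?a t' N)"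
          using finite_S assms(1) by (simp add: sum.remove)
        moreover have "(\<Sum>t'\<in>S - {t}. ?a t' N) \<le> (\<Sum>t'\<in>S - {t}. 1 / s + e)"
          using elim by (intro sum_mono) (auto intro: less_imp_le)
        moreover have "(\<Sum>t'\<in>S - {t}. 1 / s + e) = (s - 1) * (1 / s + e)"
          using finite_S assms(1) s by (simp add: s_def of_nat_diff)
        moreover have "(s - 1) * (1 / s + e) = 1 - a - e"
          using s by (simp add: e_def field_simps)
        ultimately show ?case using e by linarith
      qed
    next
      fix a assume "1 / s < a"
      then show "\<forall>\<^sub>F N in sequentially. ?a t N < a"
        using up[OF assms(1), of "a - 1 / s"] by simp
    qed
  qed
qed

end

section \<open>Unimodular matrices\<close>

definition mat2 :: "int \<Rightarrow> int \<Rightarrow> int \<Rightarrow> int \<Rightarrow> int^2^2" where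
  "mat2 a b c d = vector [vector [a, b], vector [c, d]]"

lemma mat2_nth [simp]:
  "mat2 a b c d $ 1 $ 1 = a" "mat2 a b c d $ 1 $ 2 = b"
  "mat2 a b c d $ 2 $ 1 = c" "mat2 a b c d $ 2 $ 2 = d"
  by (simp_all add: mat2_def)

lemma mat2_collapse: "mat2 (A$1$1) (A$1$2) (A$2$1) (A$2$2) = A"
  by (simp add: mat2_eq_iff)

lemma mat2_cases: obtains a b c d where "A = mat2 a b c d"
  using mat2_collapse by metis

lemma mat2_times: "mat2 a b c d ** mat2 a' b' c' d' =
    mat2 (a * a' + b * c') (a * b' + b * d') (c * a' + d * c') (c * b' + d * d')"
  by (simp add: mat2_eq_iff mat2_mult)

lemma mat_1_eq_mat2: "mat 1 = mat2 1 0 0 1"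
  by (simp add: mat2_eq_iff mat_def)

lemma uminus_mat2: "- mat2 a b c d = mat2 (- a) (- b) (- c) (- d)"
  by (simp add: mat2_eq_iff)

lemma det_mat2: "det (mat2 a b c d) = a * d - b * c"
  by (simp add: det_2)

lemma det_uminus_mat2: "det (- A :: int^2^2) = det A"
  by (simp add: det_2)

lemma uminus_mult_mat2: "- A ** B = - (A ** B)" for A B :: "int^2^2"
  by (simp add: mat2_eq_iff mat2_mult)

lemma unimodular_inverse:
  fixes A :: "int^2^2"
  assumes "\<bar>det A\<bar> = 1"
  obtains B where "A ** B = mat 1" "B ** A = mat 1" "det B = det A"
proof -
  obtain a b c d where A: "A = mat2 a b c d" by (rule mat2_cases)
  define s where "s = a * d - b * c"
  have "s = 1 \<or> s = -1" using assms by (auto simp: A det_mat2 s_def)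
  then have s2: "s * s = 1" by auto
  \<comment> \<open>The adjugate times \<open>s\<close>, as \<open>s\<close> is its own
    inverse.\<close>
  let ?B = "mat2 (s * d) (- s * b) (- s * c) (s * a)"
  have "a * (s * d) + b * (- s * c) = s * s" "c * (- s * b) + d * (s * a) = s * s"
    "(s * d) * (s * a) - (- s * b) * (- s * c) = (s * s) * s"
    by (simp_all add: s_def algebra_simps)
  then have "A ** ?B = mat 1" "?B ** A = mat 1" "det ?B = det A"
    using s2 by (simp_all add: A mat2_times mat_1_eq_mat2 det_mat2 algebra_simps flip: s_def)
  then show ?thesis by (rule that)
qed

text \<open>The proof is the Euclidean algorithm on the bottom row by column operations.\<close>

lemma unimodular_euclid:
  fixes Q :: "int \<Rightarrow> int \<Rightarrow> int \<Rightarrow> int \<Rightarrow> bool"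
  assumes one: "Q 1 0 0 1"
    and add: "\<And>a b c d. Q a b c d \<longleftrightarrow> Q a (a + b) c (c + d)"
    and swap: "\<And>a b c d. Q a b c d \<longleftrightarrow> Q b a d c"
    and neg: "\<And>a b c d. Q a b c d \<longleftrightarrow> Q (- a) (- b) (- c) (- d)"
    and det: "\<bar>a * d - b * c\<bar> = 1"
  shows "Q a b c d"
proof -
  have sub: "Q a b c d \<longleftrightarrow> Q a (b - a) c (d - c)" for a b c d
    using add[of a "b - a" c "d - c"] by simp
  \<comment> \<open>A sign change of a single column is not among the given moves; swaps and shears
    compose to one.\<close>
  have m1: "Q 1 0 0 (- 1)"
  proof -
    have "Q 1 0 0 (- 1) \<longleftrightarrow> Q 0 1 (- 1) 0" by (rule swap)
    also have "\<dots> \<longleftrightarrow> Q 0 1 (- 1) 1" by (subst sub) simp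
    also have "\<dots> \<longleftrightarrow> Q 1 0 1 (- 1)" by (rule swap)
    also have "\<dots> \<longleftrightarrow> Q 1 1 1 0" by (subst add) simp
    also have "\<dots> \<longleftrightarrow> Q 1 1 0 1" by (rule swap)
    also have "\<dots> \<longleftrightarrow> Q 1 0 0 1" by (subst sub) simp
    finally show ?thesis using one by simp
  qed
  have pos: "Q 1 b 0 d" if "\<bar>d\<bar> = 1" for b d
  proof (induction b rule: int_induct[where k = 0])
    case base
    from that have "d = 1 \<or> d = - 1" by auto
    then show ?case using one m1 by auto
  next
    case (step1 i)
    then show ?case using add[of 1 i 0 d] by (simp add: add.commute)
  next
    case (step2 i)
    then show ?case using sub[of 1 i 0 d] by simp
  qed
  have c0: "Q a b 0 d" if "\<bar>a * d\<bar> = 1" for a b d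
  proof -
    from that have "\<bar>a\<bar> = 1" "\<bar>d\<bar> = 1" by (auto simp: abs_mult zmult_eq_1_iff)
    moreover from \<open>\<bar>a\<bar> = 1\<close> have "a = 1 \<or> a = - 1" by auto
    ultimately show ?thesis using pos[of d b] pos[of "- d" "- b"] neg[of a b 0 d] by auto
  qed
  show ?thesis using det
  proof (induction "nat (\<bar>c\<bar> + \<bar>d\<bar>)" arbitrary: a b c d rule: less_induct)
    case less
    \<comment> \<open>One Euclidean step: adding or subtracting the first column, according to the
      signs, shrinks the entry \<open>d\<close>.\<close>
    have red: "Q a b c d" if dt: "\<bar>a * d - b * c\<bar> = 1" and nz: "c \<noteq> 0" "d \<noteq> 0" and le: "\<bar>c\<bar> \<le> \<bar>d\<bar>"
      and IH: "\<And>b' d'. \<bar>d'\<bar> < \<bar>d\<bar> \<Longrightarrow> \<bar>a * d' - b' * c\<bar> = 1 \<Longrightarrow> Q a b' c d'" for a b c d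
    proof (cases "\<bar>d + c\<bar> < \<bar>d\<bar>")
      case True
      have "\<bar>a * (c + d) - (a + b) * c\<bar> = 1" using dt by (simp add: algebra_simps)
      then show ?thesis using IH[of "c + d" "a + b"] True add[of a b c d] by (simp add: add.commute)
    next
      case False
      then have "\<bar>d - c\<bar> < \<bar>d\<bar>" using nz le by linarith
      moreover have "\<bar>a * (d - c) - (b - a) * c\<bar> = 1" using dt by (simp add: algebra_simps)
      ultimately show ?thesis using IH[of "d - c" "b - a"] sub[of a b c d] by simp
    qed
    consider "c = 0" | "d = 0" | "c \<noteq> 0" "d \<noteq> 0" "\<bar>c\<bar> \<le> \<bar>d\<bar>" | "c \<noteq> 0" "d \<noteq> 0" "\<bar>d\<bar> \<le> \<bar>c\<bar>"
      by linarith
    then show ?case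
    proof cases
      case 1
      then show ?thesis using less.prems c0[of a d b] by simp
    next
      case 2
      then show ?thesis using less.prems c0[of b c a] swap[of a b c d] by simp
    next
      case 3
      show ?thesis
        by (rule red[OF less.prems 3]) (rule less.hyps, auto)
    next
      case 4
      have "Q b a d c"
      proof (rule red[OF _ 4(2,1,3)])
        show "\<bar>b * c - a * d\<bar> = 1" using less.prems by (simp add: abs_minus_commute)
        fix b' d' assume "\<bar>d'\<bar> < \<bar>c\<bar>" "\<bar>b * d' - b' * d\<bar> = 1"
        then have "Q b' b d' d"
          by (intro less.hyps) (auto simp: abs_minus_commute)
        then show "Q b b' d d'" using swap by blast
      qed
      then show ?thesis using swap by blast
    qed
  qed
qed

text \<open>The Moebius map sending \<open>z\<close> to \<open>d + 1 / z\<close>, one step of a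
  continued fraction.\<close>

definition digit_mat :: "int \<Rightarrow> int^2^2" where
  "digit_mat d = mat2 d 1 1 0"

lemma det_digit_mat: "det (digit_mat d) = - 1"
  by (simp add: digit_mat_def det_mat2)

text \<open>The equivalence in \<open>digit\<close> moves \<open>P\<close> in both directions, so
  inverses of digit matrices are available although only positive digits occur. Digits 1 and 2
  already yield the column moves of the Euclidean algorithm.\<close>

lemma unimodular_digit_induct:
  fixes P :: "int^2^2 \<Rightarrow> bool"
  assumes one: "P (mat 1)"
    and digit: "\<And>A d. 0 < d \<Longrightarrow> P (A ** digit_mat d) \<longleftrightarrow> P A"
    and neg: "\<And>A. P (- A) \<longleftrightarrow> P A"
    and det: "\<bar>det A\<bar> = 1"
  shows "P A"
proof -
  define Q where "Q a b c d = P (mat2 a b c d)" for a b c d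
  have q: "Q a b c d \<longleftrightarrow> Q (a * e + b) a (c * e + d) c" if "0 < e" for a b c d e
    using digit[OF that, of "mat2 a b c d"] by (simp add: Q_def digit_mat_def mat2_times)
  have q1: "Q (a + b) a (c + d) c \<longleftrightarrow> Q a b c d" for a b c d using q[of 1 a b c d] by simp
  \<comment> \<open>Column addition is right multiplication by \<open>digit_mat 2\<close> times the
    inverse of \<open>digit_mat 1\<close>.\<close>
  have add: "Q a b c d \<longleftrightarrow> Q a (a + b) c (c + d)" for a b c d
    using q[of 2 b "a - b" d "c - d"] q[of 1 b "a - b" d "c - d"]
      q[of 2 a b c d] q1[of a "a + b" c "c + d"] by (simp add: algebra_simps)
  \<comment> \<open>\<open>digit_mat 1\<close> is that column addition followed by the swap.\<close>
  have swap: "Q a b c d \<longleftrightarrow> Q b a d c" for a b c d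
    using q1[of a "b" c "d"] add[of b a d c] add[of a b c d]  q1[of b "a - b" d "c - d"] add[of b "a - b" d "c - d"]
    by (simp add: algebra_simps)
  have "Q (A$1$1) (A$1$2) (A$2$1) (A$2$2)"
  proof (rule unimodular_euclid[where Q = Q, OF _ add swap])
    show "Q 1 0 0 1" using one by (simp add: Q_def mat_1_eq_mat2)
    show "Q a b c d \<longleftrightarrow> Q (- a) (- b) (- c) (- d)" for a b c d
      using neg[of "mat2 a b c d"] by (simp add: Q_def uminus_mat2)
    show "\<bar>A$1$1 * A$2$2 - A$1$2 * A$2$1\<bar> = 1" using det by (simp add: det_2)
  qed
  then show ?thesis by (simp add: Q_def mat2_collapse)
qed

lemma foldl_mat_mult:
  "foldl (\<lambda>A d. A ** f d) (B ** C) w = (B :: int^2^2) ** foldl (\<lambda>A d. A ** f d) C w"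
  by (induction w arbitrary: C) (simp_all flip: matrix_mul_assoc)

text \<open>Only the leading \<open>d\<close>, an integer part, may fail to be positive, hence the
  condition on the top entry. For a nonempty word the bottom entry is the top entry belonging to the
  tail, so no denominator vanishes.\<close>

lemma cf_value_eq_first_column:
  fixes w :: "nat list"
  assumes "\<forall>d\<in>set w. 0 < d"
  defines "A \<equiv> \<lambda>d. foldl (\<lambda>A d. A ** digit_mat (int d)) (digit_mat d) w"
  shows "0 < A d $ 2 $ 1" "0 < d \<Longrightarrow> 0 < A d $ 1 $ 1"
    "cf_value d (map int w) = of_int (A d $ 1 $ 1) / of_int (A d $ 2 $ 1)"
proof -
  have "0 < A d $ 2 $ 1 \<and> (0 < d \<longrightarrow> 0 < A d $ 1 $ 1) \<and>
    cf_value d (map int w) = of_int (A d $ 1 $ 1) / of_int (A d $ 2 $ 1)"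
    using assms(1) unfolding A_def
  proof (induction w arbitrary: d)
    case Nil
    show ?case by (simp add: digit_mat_def)
  next
    case (Cons e w)
    define B where "B = foldl (\<lambda>A d. A ** digit_mat (int d)) (digit_mat (int e)) w"
    have B: "0 < B $ 2 $ 1" "0 < B $ 1 $ 1"
      "cf_value (int e) (map int w) = of_int (B $ 1 $ 1) / of_int (B $ 2 $ 1)"
      using Cons.IH[of "int e"] Cons.prems by (auto simp: B_def)
    \<comment> \<open>\<open>foldl\<close> multiplies on the right while \<open>cf_value\<close>
      unfolds on the left; associativity reconciles the two.\<close>
    have "foldl (\<lambda>A d. A ** digit_mat (int d)) (digit_mat d) (e # w) = digit_mat d ** B"
      by (simp add: B_def foldl_mat_mult)
    moreover have "(digit_mat d ** B) $ 1 $ 1 = d * B $ 1 $ 1 + B $ 2 $ 1"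
      "(digit_mat d ** B) $ 2 $ 1 = B $ 1 $ 1"
      by (simp_all add: mat2_mult digit_mat_def)
    ultimately show ?case using B by (simp add: add_divide_distrib add_pos_pos)
  qed
  then show "0 < A d $ 2 $ 1" "0 < d \<Longrightarrow> 0 < A d $ 1 $ 1"
    "cf_value d (map int w) = of_int (A d $ 1 $ 1) / of_int (A d $ 2 $ 1)" by auto
qed

section \<open>Transitivity on the rational projective line, and counting cosets through an
  orbit\<close>

lemma SL2Z_act_None_transitive: "\<exists>A. det A = 1 \<and> SL2Z_act A None = z"
proof (cases z)
  case None
  show ?thesis by (rule exI[of _ "mat 1"]) (simp add: None mat_1_eq_mat2 det_mat2)
next
  case (Some r)
  obtain p q where pq: "quotient_of r = (p, q)" by fastforce
  have q: "0 < q" using quotient_of_denom_pos[OF pq] .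
  have "coprime p q" using quotient_of_coprime[OF pq] .
  then obtain u v where uv: "u * p + v * q = 1"
    using bezout_int[of p q] by (metis coprime_imp_gcd_eq_1)
  have "r = of_int p / of_int q" using quotient_of_div[OF pq] .
  then show ?thesis using q uv
    by (intro exI[of _ "mat2 p (- v) q u"]) (auto simp: det_mat2 Some algebra_simps)
qed

lemma card_image_eqI:
  assumes "\<And>x y. x \<in> A \<Longrightarrow> y \<in> A \<Longrightarrow> f x = f y \<longleftrightarrow> g x = g y"
  shows "card (f ` A) = card (g ` A)"
proof (rule bij_betw_same_card)
  let ?h = "\<lambda>z. g (inv_into A f z)"
  have h: "?h (f x) = g x" if "x \<in> A" for x
    using assms[of "inv_into A f (f x)" x] that by (simp add: f_inv_into_f inv_into_into)
  show "bij_betw ?h (f ` A) (g ` A)"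
    unfolding bij_betw_def
  proof
    show "inj_on ?h (f ` A)" using h assms by (auto intro!: inj_onI)
    show "?h ` f ` A = g ` A" using h by (auto simp: image_image)
  qed
qed

text \<open>Every coset taking \<open>y\<close> into the \<open>L\<close>-orbit of \<open>x\<close>
  has a representative \<open>u \<otimes> g0\<close> with \<open>u\<close> fixing \<open>x\<close>.
  Two such cosets agree iff the quotient of their \<open>u\<close> lies in \<open>L\<close>, and
  this quotient fixes \<open>x\<close> anyway. Thus an index of stabilizers, such as the width,
  counts cosets of \<open>L\<close>.\<close>

lemma card_rcosets_through_orbit:
  assumes act: "group_action G UNIV \<phi>" and L: "subgroup L G"
    and g0: "g0 \<in> carrier G" "\<phi> g0 y = x"
  shows "card ((\<lambda>g. L #>\<^bsub>G\<^esub> g) ` {g \<in> carrier G. \<exists>h\<in>L. \<phi> g y = \<phi> h x}) =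
    card ((\<lambda>u. {h \<in> L. \<phi> h x = x} #>\<^bsub>G\<^esub> u) ` {u \<in> carrier G. \<phi> u x = x})"
proof -
  interpret group_action G UNIV \<phi> by (rule act)
  interpret group G using group_hom by (simp add: group_hom_def)
  interpret L: subgroup L G by (rule L)
  let ?A = "{u \<in> carrier G. \<phi> u x = x}" and ?Lx = "{h \<in> L. \<phi> h x = x}"
  have mult: "\<phi> (a \<otimes>\<^bsub>G\<^esub> b) z = \<phi> a (\<phi> b z)" if "a \<in> carrier G" "b \<in> carrier G" for a b z
    using composition_rule[of z a b] that by simp
  have one: "\<phi> \<one>\<^bsub>G\<^esub> z = z" for z using id_eq_one by (metis UNIV_I restrict_apply)
  have inv: "\<phi> (inv\<^bsub>G\<^esub> a) (\<phi> a z) = z" if "a \<in> carrier G" for a z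
    using mult[of "inv\<^bsub>G\<^esub> a" a z] that one by simp
  have subLx: "subgroup ?Lx G"
  proof (rule subgroupI)
    show "?Lx \<noteq> {}" using L.one_closed one by blast
    show "inv\<^bsub>G\<^esub> a \<in> ?Lx" if "a \<in> ?Lx" for a
      using that inv[of a x] by auto
    show "a \<otimes>\<^bsub>G\<^esub> b \<in> ?Lx" if "a \<in> ?Lx" "b \<in> ?Lx" for a b
      using that mult by auto
  qed auto
  have eq_iff: "M #>\<^bsub>G\<^esub> a = M #>\<^bsub>G\<^esub> b \<longleftrightarrow> a \<otimes>\<^bsub>G\<^esub> inv\<^bsub>G\<^esub> b \<in> M"
    if "subgroup M G" "a \<in> carrier G" "b \<in> carrier G" for M a b
  proof
    interpret M: subgroup M G by (rule that)
    assume "M #>\<^bsub>G\<^esub> a = M #>\<^bsub>G\<^esub> b"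
    then have "a \<in> M #>\<^bsub>G\<^esub> b" using that(2) rcos_self[OF that(2,1)] by simp
    then obtain m where "m \<in> M" "a = m \<otimes>\<^bsub>G\<^esub> b" by (auto simp: r_coset_def)
    then show "a \<otimes>\<^bsub>G\<^esub> inv\<^bsub>G\<^esub> b \<in> M" using that by (simp add: m_assoc)
  next
    interpret M: subgroup M G by (rule that)
    assume m: "a \<otimes>\<^bsub>G\<^esub> inv\<^bsub>G\<^esub> b \<in> M"
    have "a = (a \<otimes>\<^bsub>G\<^esub> inv\<^bsub>G\<^esub> b) \<otimes>\<^bsub>G\<^esub> b" using that by (simp add: m_assoc)
    then have "a \<in> M #>\<^bsub>G\<^esub> b" using m by (auto simp: r_coset_def)
    then show "M #>\<^bsub>G\<^esub> a = M #>\<^bsub>G\<^esub> b" using repr_independence[OF _ that(3,1)] by simp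
  qed
  have "(\<lambda>g. L #>\<^bsub>G\<^esub> g) ` {g \<in> carrier G. \<exists>h\<in>L. \<phi> g y = \<phi> h x} = (\<lambda>u. L #>\<^bsub>G\<^esub> (u \<otimes>\<^bsub>G\<^esub> g0)) ` ?A"
  proof (intro equalityI subsetI)
    fix C assume "C \<in> (\<lambda>g. L #>\<^bsub>G\<^esub> g) ` {g \<in> carrier G. \<exists>h\<in>L. \<phi> g y = \<phi> h x}"
    then obtain g h where g: "g \<in> carrier G" "h \<in> L" "\<phi> g y = \<phi> h x" "C = L #>\<^bsub>G\<^esub> g" by blast
    have hG: "h \<in> carrier G" using g(2) by simp
    define u where "u = inv\<^bsub>G\<^esub> h \<otimes>\<^bsub>G\<^esub> g \<otimes>\<^bsub>G\<^esub> inv\<^bsub>G\<^esub> g0"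
    have uG: "u \<in> carrier G" using g hG g0 by (simp add: u_def)
    have "\<phi> u x = \<phi> (inv\<^bsub>G\<^esub> h) (\<phi> g (\<phi> (inv\<^bsub>G\<^esub> g0) x))"
      using g hG g0 by (simp add: u_def mult)
    then have "\<phi> u x = x" using g(3) inv[of g0 y] inv[OF hG] g0 by simp
    moreover have e: "u \<otimes>\<^bsub>G\<^esub> g0 = inv\<^bsub>G\<^esub> h \<otimes>\<^bsub>G\<^esub> g" using g hG g0 by (simp add: u_def m_assoc)
    have "g \<otimes>\<^bsub>G\<^esub> inv\<^bsub>G\<^esub> (inv\<^bsub>G\<^esub> h \<otimes>\<^bsub>G\<^esub> g) = h"
      using g hG by (simp add: inv_mult_group flip: m_assoc)
    then have "L #>\<^bsub>G\<^esub> g = L #>\<^bsub>G\<^esub> (u \<otimes>\<^bsub>G\<^esub> g0)"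
      using g hG by (subst eq_iff[OF L]) (auto simp: e)
    ultimately show "C \<in> (\<lambda>u. L #>\<^bsub>G\<^esub> (u \<otimes>\<^bsub>G\<^esub> g0)) ` ?A" using uG g(4) by blast
  next
    fix C assume "C \<in> (\<lambda>u. L #>\<^bsub>G\<^esub> (u \<otimes>\<^bsub>G\<^esub> g0)) ` ?A"
    then obtain u where u: "u \<in> carrier G" "\<phi> u x = x" "C = L #>\<^bsub>G\<^esub> (u \<otimes>\<^bsub>G\<^esub> g0)" by blast
    have "\<phi> (u \<otimes>\<^bsub>G\<^esub> g0) y = \<phi> \<one>\<^bsub>G\<^esub> x" using u g0 by (simp add: mult one)
    then show "C \<in> (\<lambda>g. L #>\<^bsub>G\<^esub> g) ` {g \<in> carrier G. \<exists>h\<in>L. \<phi> g y = \<phi> h x}"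
      using u g0 L.one_closed by blast
  qed
  also have "card \<dots> = card ((\<lambda>u. ?Lx #>\<^bsub>G\<^esub> u) ` ?A)"
  proof (rule card_image_eqI)
    fix u v assume u: "u \<in> ?A" and v: "v \<in> ?A"
    then have uv: "u \<in> carrier G" "v \<in> carrier G" "\<phi> u x = x" "\<phi> v x = x" by auto
    have "(u \<otimes>\<^bsub>G\<^esub> g0) \<otimes>\<^bsub>G\<^esub> inv\<^bsub>G\<^esub> (v \<otimes>\<^bsub>G\<^esub> g0) = u \<otimes>\<^bsub>G\<^esub> inv\<^bsub>G\<^esub> v"
      using uv g0 by (simp add: inv_mult_group m_assoc) (simp flip: m_assoc)
    moreover have "\<phi> (u \<otimes>\<^bsub>G\<^esub> inv\<^bsub>G\<^esub> v) x = x"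
      using uv inv[of v x] by (simp add: mult)
    ultimately show "L #>\<^bsub>G\<^esub> (u \<otimes>\<^bsub>G\<^esub> g0) = L #>\<^bsub>G\<^esub> (v \<otimes>\<^bsub>G\<^esub> g0) \<longleftrightarrow> ?Lx #>\<^bsub>G\<^esub> u = ?Lx #>\<^bsub>G\<^esub> v"
      using uv g0 by (simp add: eq_iff[OF L] eq_iff[OF subLx])
  qed
  finally show ?thesis .
qed

section \<open>Cosets and cusps\<close>

lemma PSL_image_eq: "PSL_image H = (\<lambda>A. {A, - A}) ` H"
  by (simp add: PSL_image_def r_coset_pm_one)

lemma PSL_rcoset:
  "PSL_image H #>\<^bsub>PSL2Z\<^esub> {A, - A} = (\<lambda>B. {B ** A, - (B ** A)}) ` H"
  by (auto simp: r_coset_def PSL_image_eq PSL2Z_mult)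

text \<open>A coset of the image of \<open>H\<close> in $\mathrm{PSL}(2,\mathbb{Z})$ is represented by the union of its
  elements $\{B, -B\}$; this also makes sense for determinant $-1$.\<close>

definition mat_coset :: "(int^2^2) set \<Rightarrow> int^2^2 \<Rightarrow> (int^2^2) set" where
  "mat_coset H A = (\<lambda>B. B ** A) ` (H \<union> uminus ` H)"

definition step :: "nat \<Rightarrow> (int^2^2) set \<Rightarrow> (int^2^2) set" where
  "step d C = (\<lambda>B. B ** digit_mat (int d)) ` C"

definition unimodular_cosets :: "(int^2^2) set \<Rightarrow> (int^2^2) set set" where
  "unimodular_cosets H = mat_coset H ` {A. \<bar>det A\<bar> = 1}"

text \<open>For either determinant \<open>SL2Z_act A None\<close> is the ratio of the first column
  of \<open>A\<close>, which for a product of digit matrices is the approximant.\<close>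

definition cusp_cosets :: "(int^2^2) set \<Rightarrow> rat option set \<Rightarrow> (int^2^2) set set" where
  "cusp_cosets H \<kappa> = mat_coset H ` {A. \<bar>det A\<bar> = 1 \<and> SL2Z_act A None \<in> \<kappa>}"

lemma image_mult_mat_coset: "(\<lambda>B. B ** M) ` mat_coset H A = mat_coset H (A ** M)"
  by (simp add: mat_coset_def image_image matrix_mul_assoc)

lemma step_mat_coset: "step d (mat_coset H A) = mat_coset H (A ** digit_mat (int d))"
  by (simp add: step_def image_mult_mat_coset)

lemma foldl_step_mat_coset:
  "foldl (\<lambda>s d. step d s) (mat_coset H A) w =
     mat_coset H (foldl (\<lambda>A d. A ** digit_mat (int d)) A w)"
  by (induction w arbitrary: A) (simp_all add: step_mat_coset)

lemma abs_det_mult_digit_mat: "\<bar>det (A ** digit_mat d)\<bar> = \<bar>det A\<bar>"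
  by (simp add: det_mul det_digit_mat)

locale SL2Z_subgroup =
  fixes H :: "(int^2^2) set"
  assumes H: "subgroup H SL2Z" and fin: "finite (rcosets\<^bsub>SL2Z\<^esub> H)"
begin

lemma det_H: "B \<in> H \<Longrightarrow> det B = 1"
  using subgroup.subset[OF H] by auto

lemma one_H: "mat 1 \<in> H"
  using subgroup.one_closed[OF H] by simp

lemma mult_H: "A \<in> H \<Longrightarrow> B \<in> H \<Longrightarrow> A ** B \<in> H"
  using subgroup.m_closed[OF H, of A B] by simp

lemma mat_coset_uminus: "mat_coset H (- A) = mat_coset H A"
proof -
  have "B ** - A = - B ** A" for B :: "int^2^2"
    by (simp add: mat2_eq_iff mat2_mult)
  then have "mat_coset H (- A) = (\<lambda>B. B ** A) ` uminus ` (H \<union> uminus ` H)"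
    unfolding mat_coset_def by (simp only: image_image)
  also have "uminus ` (H \<union> uminus ` H) = H \<union> uminus ` H"
    by (auto simp: image_image image_Un)
  finally show ?thesis by (simp only: mat_coset_def)
qed

lemma self_mat_coset: "A \<in> mat_coset H A"
  using one_H by (auto simp: mat_coset_def intro!: image_eqI[of _ _ "mat 1"])

lemma det_mat_coset: "B \<in> mat_coset H A \<Longrightarrow> det B = det A"
  by (auto simp: mat_coset_def det_mul det_H det_uminus_mat2)

lemma mat_coset_PSL: "(\<lambda>B. {B, - B}) ` mat_coset H A = PSL_image H #>\<^bsub>PSL2Z\<^esub> {A, - A}"
  unfolding PSL_rcoset mat_coset_def image_Un image_image uminus_mult_mat2
  by (auto simp: insert_commute)

lemma Union_mat_coset_PSL: "\<Union> ((\<lambda>B. {B, - B}) ` mat_coset H A) = mat_coset H A"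
  by (force simp: mat_coset_def uminus_mult_mat2 image_Un image_image)

text \<open>Replacing each \<open>B\<close> in a coset by the pair of \<open>B\<close> and
  \<open>- B\<close> is undone by \<open>Union\<close>, hence injective, so the counting can be done
  in \<open>PSL2Z\<close>.\<close>

lemma card_SL_cosets:
  assumes "\<And>A. P A \<longleftrightarrow> R {A, - A}"
  shows "card (mat_coset H ` {A. det A = 1 \<and> P A}) =
    card ((\<lambda>g. PSL_image H #>\<^bsub>PSL2Z\<^esub> g) ` {g \<in> carrier PSL2Z. R g})"
proof -
  have "{g \<in> carrier PSL2Z. R g} = (\<lambda>A. {A, - A}) ` {A. det A = 1 \<and> P A}"
    using assms by (auto simp: carrier_PSL2Z)
  then have "(\<lambda>g. PSL_image H #>\<^bsub>PSL2Z\<^esub> g) ` {g \<in> carrier PSL2Z. R g} =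
      (`) (\<lambda>B. {B, - B}) ` mat_coset H ` {A. det A = 1 \<and> P A}"
    by (simp add: image_image mat_coset_PSL)
  moreover have "inj_on ((`) (\<lambda>B. {B, - B})) (mat_coset H ` {A. det A = 1 \<and> P A})"
  proof (rule inj_on_inverseI[where g = Union])
    fix C assume "C \<in> mat_coset H ` {A. det A = 1 \<and> P A}"
    then obtain A where "C = mat_coset H A" by blast
    then show "\<Union> ((\<lambda>B. {B, - B}) ` C) = C" by (simp only: Union_mat_coset_PSL)
  qed
  ultimately show ?thesis by (simp add: card_image)
qed

lemma finite_SL_cosets: "finite (mat_coset H ` {A. det A = 1})"
proof -
  have "mat_coset H A = (H #>\<^bsub>SL2Z\<^esub> A) \<union> uminus ` (H #>\<^bsub>SL2Z\<^esub> A)" for A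
    by (auto simp: mat_coset_def r_coset_def uminus_mult_mat2 image_Un image_image)
  then have "mat_coset H ` {A. det A = 1} = (\<lambda>C. C \<union> uminus ` C) ` (rcosets\<^bsub>SL2Z\<^esub> H)"
    by (auto simp: RCOSETS_def)
  then show ?thesis using fin by simp
qed

text \<open>Multiplication by $\mathrm{diag}(1,-1)$ on the right preserves the first column, so it matches
  the cosets of determinant $-1$ with those of determinant $1$ and preserves the cusp.\<close>

lemma unimodular_cosets_split:
  assumes "\<And>A. P (A ** mat2 1 0 0 (- 1)) \<longleftrightarrow> P A"
    and "finite (mat_coset H ` {A. det A = 1 \<and> P A})"
  shows "finite (mat_coset H ` {A. \<bar>det A\<bar> = 1 \<and> P A})"
    "card (mat_coset H ` {A. \<bar>det A\<bar> = 1 \<and> P A}) = 2 * card (mat_coset H ` {A. det A = 1 \<and> P A})"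
proof -
  let ?e = "mat2 1 0 0 (- 1)"
  let ?f = "(`) (\<lambda>B :: int^2^2. B ** ?e)"
  let ?X = "mat_coset H ` {A. det A = 1 \<and> P A}"
  have ee: "B ** ?e ** ?e = B" for B :: "int^2^2"
    by (simp add: mat2_eq_iff mat2_mult)
  have de: "det (B ** ?e) = - det B" for B :: "int^2^2"
    by (simp add: det_mul det_mat2)
  have "{A. \<bar>det A\<bar> = 1 \<and> P A} = {A. det A = 1 \<and> P A} \<union> (\<lambda>A. A ** ?e) ` {A. det A = 1 \<and> P A}"
  proof (intro equalityI subsetI)
    fix A assume A: "A \<in> {A. \<bar>det A\<bar> = 1 \<and> P A}"
    show "A \<in> {A. det A = 1 \<and> P A} \<union> (\<lambda>A. A ** ?e) ` {A. det A = 1 \<and> P A}"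
    proof (cases "det A = 1")
      case False
      then have "det (A ** ?e) = 1" using A by (auto simp: de)
      then have "A ** ?e \<in> {A. det A = 1 \<and> P A}" using A assms(1) by simp
      moreover have "A = (A ** ?e) ** ?e" by (simp add: ee)
      ultimately show ?thesis by blast
    qed (use A in auto)
  qed (auto simp: de assms(1))
  then have eq: "mat_coset H ` {A. \<bar>det A\<bar> = 1 \<and> P A} = ?X \<union> ?f ` ?X"
    by (simp add: image_Un image_image image_mult_mat_coset)
  then show "finite (mat_coset H ` {A. \<bar>det A\<bar> = 1 \<and> P A})" using assms(2) by simp
  have "?X \<inter> ?f ` ?X = {}"
  proof (rule ccontr)
    assume "?X \<inter> ?f ` ?X \<noteq> {}"
    then obtain A B where AB: "det A = 1" "det B = 1" "mat_coset H A = mat_coset H (B ** ?e)"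
      by (auto simp: image_mult_mat_coset)
    then have "A \<in> mat_coset H (B ** ?e)" using self_mat_coset[of A] by simp
    then show False using AB det_mat_coset[of A "B ** ?e"] by (simp add: de)
  qed
  moreover have "card (?f ` ?X) = card ?X"
  proof (rule card_image, rule inj_on_inverseI[where g = ?f])
    show "?f (?f C) = C" for C by (simp add: image_image ee)
  qed
  ultimately show "card (mat_coset H ` {A. \<bar>det A\<bar> = 1 \<and> P A}) = 2 * card ?X"
    unfolding eq using assms(2) by (subst card_Un_disjoint) auto
qed

lemma finite_unimodular_cosets: "finite (unimodular_cosets H)"
  using unimodular_cosets_split(1)[of "\<lambda>_. True"] finite_SL_cosets
  by (simp add: unimodular_cosets_def)

lemma card_unimodular_cosets: "card (unimodular_cosets H) = 2 * group_index PSL2Z (PSL_image H)"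
proof -
  have "card (mat_coset H ` {A. det A = 1}) = group_index PSL2Z (PSL_image H)"
    using card_SL_cosets[of "\<lambda>_. True" "\<lambda>_. True"]
    by (simp add: group_index_def RCOSETS_def UNION_singleton_eq_range flip: image_def)
  then show ?thesis
    using unimodular_cosets_split(2)[of "\<lambda>_. True"] finite_SL_cosets
    by (simp add: unimodular_cosets_def)
qed

lemma act_None_mult: "SL2Z_act (A ** mat2 1 0 0 (- 1)) None = SL2Z_act A None"
  by (simp add: mat2_mult)

text \<open>\<open>card_rcosets_through_orbit\<close> with \<open>y = None\<close> identifies the
  number of cosets of determinant 1 with the width; the reflected cosets of determinant -1 double
  it.\<close>

lemma card_cusp_cosets:
  assumes \<kappa>: "\<kappa> \<in> cusps H"
  shows "card (cusp_cosets H \<kappa>) = 2 * cusp_width H \<kappa>"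
proof -
  interpret P: group PSL2Z by (rule group_PSL2Z)
  obtain x where x: "\<kappa> = orbit (PSL_restrict (PSL_image H)) PSL_act x"
    using \<kappa> by (auto simp: cusps_def orbits_def)
  then have xo: "\<kappa> = {PSL_act h x | h. h \<in> PSL_image H}"
    by (simp add: orbit_def PSL_restrict_def)
  have sub: "subgroup (PSL_image H) PSL2Z" by (rule subgroup_PSL_image[OF H])
  have "PSL_act \<one>\<^bsub>PSL2Z\<^esub> x \<in> \<kappa>" using subgroup.one_closed[OF sub] unfolding xo by blast
  then have xk: "x \<in> \<kappa>" by (simp add: PSL_act_one)
  obtain A0 where A0: "det A0 = 1" "SL2Z_act A0 None = x" using SL2Z_act_None_transitive by blast
  have "card (mat_coset H ` {A. det A = 1 \<and> SL2Z_act A None \<in> \<kappa>}) =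
      card ((\<lambda>g. PSL_image H #>\<^bsub>PSL2Z\<^esub> g) ` {g \<in> carrier PSL2Z. PSL_act g None \<in> \<kappa>})"
    by (rule card_SL_cosets) (simp add: PSL_act_eq)
  also have "{g \<in> carrier PSL2Z. PSL_act g None \<in> \<kappa>} =
      {g \<in> carrier PSL2Z. \<exists>h\<in>PSL_image H. PSL_act g None = PSL_act h x}"
    unfolding xo by auto
  also have "card ((\<lambda>g. PSL_image H #>\<^bsub>PSL2Z\<^esub> g) ` \<dots>) =
      card ((\<lambda>u. {h \<in> PSL_image H. PSL_act h x = x} #>\<^bsub>PSL2Z\<^esub> u) ` {u \<in> carrier PSL2Z. PSL_act u x = x})"
  proof (rule card_rcosets_through_orbit[OF group_action_PSL2Z sub])
    show "{A0, - A0} \<in> carrier PSL2Z" using A0 by (auto simp: carrier_PSL2Z)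
    show "PSL_act {A0, - A0} None = x" using A0 by (simp add: PSL_act_eq)
  qed
  also have "\<dots> = width_at H x"
    by (simp add: width_at_def group_index_def RCOSETS_def r_coset_def PSL_restrict_def stabilizer_def
        UNION_singleton_eq_range flip: image_def)
  also have "\<dots> = cusp_width H \<kappa>" using cusp_width_eq[OF H \<kappa> xk] by simp
  finally have c: "card (mat_coset H ` {A. det A = 1 \<and> SL2Z_act A None \<in> \<kappa>}) = cusp_width H \<kappa>" .
  have "finite (mat_coset H ` {A. det A = 1 \<and> SL2Z_act A None \<in> \<kappa>})"
    by (rule finite_subset[OF _ finite_SL_cosets]) auto
  then show ?thesis
    unfolding cusp_cosets_def using unimodular_cosets_split(2)[of "\<lambda>A. SL2Z_act A None \<in> \<kappa>"] c
    by (simp only: act_None_mult)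
qed

text \<open>Representatives of one coset differ by a sign and a left factor from \<open>H\<close>,
  which keeps the image of \<open>None\<close> in the same cusp. So membership can be tested on any
  representative.\<close>

lemma mat_coset_in_cusp_cosets_iff:
  assumes \<kappa>: "\<kappa> \<in> cusps H" and A: "\<bar>det A\<bar> = 1"
  shows "mat_coset H A \<in> cusp_cosets H \<kappa> \<longleftrightarrow> SL2Z_act A None \<in> \<kappa>"
proof
  assume "mat_coset H A \<in> cusp_cosets H \<kappa>"
  then obtain B where B: "mat_coset H A = mat_coset H B" "SL2Z_act B None \<in> \<kappa>"
    by (auto simp: cusp_cosets_def)
  obtain x where "\<kappa> = orbit (PSL_restrict (PSL_image H)) PSL_act x"
    using \<kappa> by (auto simp: cusps_def orbits_def)
  then have xo: "\<kappa> = {SL2Z_act h x | h. h \<in> H}"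
    by (simp add: orbit_def PSL_restrict_def PSL_image_eq Setcompr_eq_image image_image PSL_act_eq)
  obtain h where h: "h \<in> H" "A = h ** B \<or> A = - (h ** B)"
    using self_mat_coset[of A] unfolding B(1) by (auto simp: mat_coset_def uminus_mult_mat2)
  have "SL2Z_act (h ** B) None = SL2Z_act h (SL2Z_act B None)"
  proof -
    have "\<bar>det B\<bar> = 1" using h A det_H[OF h(1)] by (auto simp: det_mul det_uminus_mat2)
    show ?thesis
    proof (cases "det B = 1")
      case True
      then show ?thesis by (rule SL2Z_act_mult)
    next
      case False
      \<comment> \<open>\<open>SL2Z_act_mult\<close> requires determinant 1 of the right factor; the
        reflection achieves this without changing the image of \<open>None\<close>.\<close>
      then have d: "det (B ** mat2 1 0 0 (- 1)) = 1"
        using \<open>\<bar>det B\<bar> = 1\<close> by (auto simp: det_mul det_mat2)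
      have "SL2Z_act (h ** B) None = SL2Z_act (h ** (B ** mat2 1 0 0 (- 1))) None"
        by (simp add: matrix_mul_assoc act_None_mult del: SL2Z_act.simps)
      also have "\<dots> = SL2Z_act h (SL2Z_act B None)"
        using SL2Z_act_mult[OF d] by (simp add: act_None_mult del: SL2Z_act.simps)
      finally show ?thesis .
    qed
  qed
  then have "SL2Z_act A None = SL2Z_act h (SL2Z_act B None)"
    using h(2) by (auto simp: SL2Z_act_uminus simp del: SL2Z_act.simps)
  moreover obtain k where k: "k \<in> H" "SL2Z_act B None = SL2Z_act k x" using B(2) unfolding xo by auto
  ultimately have "SL2Z_act A None = SL2Z_act (h ** k) x"
    using SL2Z_act_mult[OF det_H[OF k(1)]] by simp
  then show "SL2Z_act A None \<in> \<kappa>" unfolding xo using mult_H[OF h(1) k(1)] by blast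
qed (use A in \<open>auto simp: cusp_cosets_def\<close>)

section \<open>The digits permute the cosets transitively\<close>

lemma step_bij: "bij_betw (step d) (unimodular_cosets H) (unimodular_cosets H)"
proof (rule bij_betw_byWitness[where f' = "\<lambda>C. (\<lambda>B. B ** mat2 0 1 1 (- int d)) ` C"])
  have inv: "A ** digit_mat (int d) ** mat2 0 1 1 (- int d) = A"
    "A ** mat2 0 1 1 (- int d) ** digit_mat (int d) = A" for A :: "int^2^2"
    by (simp_all add: mat2_eq_iff mat2_mult digit_mat_def algebra_simps)
  show "\<forall>C\<in>unimodular_cosets H. (\<lambda>B. B ** mat2 0 1 1 (- int d)) ` step d C = C"
    "\<forall>C\<in>unimodular_cosets H. step d ((\<lambda>B. B ** mat2 0 1 1 (- int d)) ` C) = C"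
    by (simp_all add: step_def image_image inv)
  show "step d ` unimodular_cosets H \<subseteq> unimodular_cosets H"
    using abs_det_mult_digit_mat by (auto simp: unimodular_cosets_def step_mat_coset)
  show "(\<lambda>C. (\<lambda>B. B ** mat2 0 1 1 (- int d)) ` C) ` unimodular_cosets H \<subseteq> unimodular_cosets H"
    by (auto simp: unimodular_cosets_def image_mult_mat_coset det_mul det_mat2)
qed

text \<open>The set \<open>R\<close> of reachable cosets is finite and each \<open>step d\<close>
  with \<open>0 < d\<close> maps it injectively into itself, hence onto itself. So \<open>R\<close>
  is closed under backward steps too, as \<open>unimodular_digit_induct\<close> demands.\<close>

lemma step_transitive:
  assumes "\<sigma> \<in> unimodular_cosets H" "\<tau> \<in> unimodular_cosets H"
  shows "\<exists>w\<in>{w. \<forall>d\<in>set w. 0 < d}. foldl (\<lambda>s d. step d s) \<sigma> w = \<tau>"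
proof -
  define R where "R = {foldl (\<lambda>s d. step d s) \<sigma> w | w. \<forall>d\<in>set w. 0 < d}"
  have "foldl (\<lambda>s d. step d s) C w \<in> unimodular_cosets H" if "C \<in> unimodular_cosets H" for C w
    using that by (induction w arbitrary: C) (use bij_betw_apply[OF step_bij] in auto)
  then have RS: "R \<subseteq> unimodular_cosets H" using assms by (auto simp: R_def)
  have fwd: "step d C \<in> R" if "C \<in> R" "0 < d" for C d
  proof -
    from that(1) obtain w where "C = foldl (\<lambda>s d. step d s) \<sigma> w" "\<forall>d\<in>set w. 0 < d"
      unfolding R_def by blast
    with that(2) have "step d C = foldl (\<lambda>s d. step d s) \<sigma> (w @ [d])" "\<forall>d\<in>set (w @ [d]). 0 < d"
      by auto
    then show ?thesis unfolding R_def by blast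
  qed
  have bwd: "C \<in> R" if "step d C \<in> R" "0 < d" "C \<in> unimodular_cosets H" for C d
  proof -
    have inj: "inj_on (step d) (unimodular_cosets H)" using step_bij by (simp add: bij_betw_def)
    have "step d ` R = R"
    proof (rule endo_inj_surj)
      show "finite R" using RS finite_unimodular_cosets by (rule finite_subset)
      show "step d ` R \<subseteq> R" using fwd that(2) by blast
      show "inj_on (step d) R" using inj RS by (rule inj_on_subset)
    qed
    then have "step d C \<in> step d ` R" using that(1) by simp
    then obtain C' where "C' \<in> R" "step d C = step d C'" by blast
    then show ?thesis using inj that(3) RS by (auto dest: inj_onD)
  qed
  obtain A B where A: "\<bar>det A\<bar> = 1" "\<sigma> = mat_coset H A" and B: "\<bar>det B\<bar> = 1" "\<tau> = mat_coset H B"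
    using assms by (auto simp: unimodular_cosets_def)
  obtain A' where A': "A ** A' = mat 1" "det A' = det A" using unimodular_inverse[OF A(1)] by blast
  \<comment> \<open>The induction varies \<open>M\<close> in the representative
    \<open>A ** M\<close> and ends at \<open>M = A' ** B\<close>. The determinant is a premise
    inside the property because the step hypotheses range over all matrices, while backward closure
    needs a member of \<open>unimodular_cosets H\<close>.\<close>
  have "\<bar>det (A' ** B)\<bar> = 1 \<longrightarrow> mat_coset H (A ** (A' ** B)) \<in> R"
  proof (rule unimodular_digit_induct[where P = "\<lambda>M. \<bar>det M\<bar> = 1 \<longrightarrow> mat_coset H (A ** M) \<in> R"])
    have "foldl (\<lambda>s d. step d s) \<sigma> [] \<in> R" unfolding R_def by (rule CollectI, rule exI[of _ "[]"]) simp
    then show "\<bar>det (mat 1 :: int^2^2)\<bar> = 1 \<longrightarrow> mat_coset H (A ** mat 1) \<in> R" using A by simp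
    show "(\<bar>det (M ** digit_mat d)\<bar> = 1 \<longrightarrow> mat_coset H (A ** (M ** digit_mat d)) \<in> R) \<longleftrightarrow>
        (\<bar>det M\<bar> = 1 \<longrightarrow> mat_coset H (A ** M) \<in> R)" if "0 < d" for M d
    proof -
      have e: "mat_coset H (A ** (M ** digit_mat d)) = step (nat d) (mat_coset H (A ** M))"
        using that by (simp add: step_mat_coset matrix_mul_assoc)
      have pos: "0 < nat d" using that by simp
      show ?thesis
        unfolding abs_det_mult_digit_mat e
      proof (rule imp_cong[OF refl])
        assume "\<bar>det M\<bar> = 1"
        then have "mat_coset H (A ** M) \<in> unimodular_cosets H"
          using A by (auto simp: unimodular_cosets_def det_mul abs_mult)
        then show "step (nat d) (mat_coset H (A ** M)) \<in> R \<longleftrightarrow> mat_coset H (A ** M) \<in> R"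
          using fwd[OF _ pos] bwd[OF _ pos] by blast
      qed
    qed
    show "(\<bar>det (- M)\<bar> = 1 \<longrightarrow> mat_coset H (A ** - M) \<in> R) \<longleftrightarrow>
        (\<bar>det M\<bar> = 1 \<longrightarrow> mat_coset H (A ** M) \<in> R)" for M
    proof -
      have "A ** - M = - (A ** M)" by (simp add: mat2_eq_iff mat2_mult)
      then show ?thesis by (simp add: mat_coset_uminus det_uminus_mat2)
    qed
    show "\<bar>det (A' ** B)\<bar> = 1" using A A' B by (simp add: det_mul abs_mult)
  qed
  moreover have "\<bar>det (A' ** B)\<bar> = 1" using A A' B by (simp add: det_mul abs_mult)
  ultimately have "\<tau> \<in> R" using A' B by (simp add: matrix_mul_assoc)
  then show ?thesis by (auto simp: R_def)
qed

end

section \<open>Equidistribution of the approximants\<close>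

lemma digits_Suc_snoc: "digits (Suc n) x = digits n x @ [first_digit ((gauss_map ^^ n) x)]"
  using digits_add[of n 1 x] by simp

lemma cf_digit_eq_digits:
  assumes "x - of_int \<lfloor>x\<rfloor> \<in> irr_unit"
  shows "map (cf_digit x) [1..<Suc n] = map int (digits n (x - of_int \<lfloor>x\<rfloor>))"
proof (induction n)
  case (Suc n)
  let ?z = "(gauss_map ^^ n) (x - of_int \<lfloor>x\<rfloor>)"
  have "0 < ?z" using gauss_map_iter_in_irr_unit[OF assms] by (rule irr_unitD)
  then have "cf_digit x (Suc n) = int (first_digit ?z)"
    by (simp add: first_digit_def)
  moreover have "[1..<Suc (Suc n)] = [1..<Suc n] @ [Suc n]" by simp
  ultimately show ?case using Suc.IH by (simp only: map_append list.map digits_Suc_snoc)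
qed simp

text \<open>Carries statements about the unit interval to every interval between consecutive
  integers.\<close>

lemma AE_lborel_translate:
  fixes a :: real
  assumes "AE x in lborel. P x"
  shows "AE x in lborel. P (x - a)"
proof -
  from assms obtain N where N: "\<And>x. x \<in> space lborel - N \<Longrightarrow> P x" "N \<in> null_sets lborel"
    by (rule AE_E3) (rule that)
  show ?thesis
    by (rule AE_I'[OF null_sets_translation[OF N(2), of a]]) (use N(1) in auto)
qed

lemma (in digit_action) visit_frequency_set:
  assumes "\<sigma> \<in> S" "G \<subseteq> S"
  shows "AE x in lborel. x \<in> irr_unit \<longrightarrow>
    (\<lambda>N. real (card {n. n \<le> N \<and> state n x \<sigma> \<in> G}) / real N) \<longlonglongrightarrow> real (card G) / real (card S)"
proof -
  have fG: "finite G" using assms(2) finite_S by (rule finite_subset)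
  have "AE x in lborel. \<forall>t\<in>G. x \<in> irr_unit \<longrightarrow>
      (\<lambda>N. real (visits t \<sigma> N x) / real N) \<longlonglongrightarrow> 1 / real (card S)"
    using fG assms by (intro AE_finite_allI visit_frequency) auto
  then show ?thesis
  proof (rule AE_mp, intro AE_I2 impI)
    fix x
    assume x: "x \<in> irr_unit" and lim: "\<forall>t\<in>G. x \<in> irr_unit \<longrightarrow>
      (\<lambda>N. real (visits t \<sigma> N x) / real N) \<longlonglongrightarrow> 1 / real (card S)"
    have "(\<lambda>N. \<Sum>t\<in>G. real (visits t \<sigma> N x) / real N) \<longlonglongrightarrow> (\<Sum>t\<in>G. 1 / real (card S))"
      by (intro tendsto_sum) (use lim x in auto)
    \<comment> \<open>\<open>visits\<close> counts times strictly below its bound, while the goal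
      counts times up to \<open>N\<close> and divides by \<open>N\<close>; hence the shift to
      \<open>Suc N\<close> and a correcting factor that tends to 1.\<close>
    then have "(\<lambda>N. \<Sum>t\<in>G. real (visits t \<sigma> (Suc N) x) / real (Suc N)) \<longlonglongrightarrow> real (card G) / real (card S)"
      by (intro LIMSEQ_Suc) simp
    moreover have "(\<lambda>N. real (Suc N) / real N) \<longlonglongrightarrow> 1"
      by (rule LIMSEQ_Suc_n_over_n)
    ultimately have "(\<lambda>N. (\<Sum>t\<in>G. real (visits t \<sigma> (Suc N) x) / real (Suc N)) * (real (Suc N) / real N))
        \<longlonglongrightarrow> real (card G) / real (card S) * 1"
      by (rule tendsto_mult)
    moreover have "(\<Sum>t\<in>G. real (visits t \<sigma> (Suc N) x) / real (Suc N)) * (real (Suc N) / real N) =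
        real (card {n. n \<le> N \<and> state n x \<sigma> \<in> G}) / real N" for N
    proof -
      have "{n. n \<le> N \<and> state n x \<sigma> \<in> G} = (\<Union>t\<in>G. {n. n < Suc N \<and> state n x \<sigma> = t})"
        by (auto simp: less_Suc_eq_le)
      also have "card \<dots> = (\<Sum>t\<in>G. visits t \<sigma> (Suc N) x)"
        unfolding visits_def by (rule card_UN_disjoint) (use fG in auto)
      finally show ?thesis by (simp add: sum_divide_distrib[symmetric])
    qed
    ultimately show "(\<lambda>N. real (card {n. n \<le> N \<and> state n x \<sigma> \<in> G}) / real N)
        \<longlonglongrightarrow> real (card G) / real (card S)"
      by (simp only: mult_1_right)
  qed
qed

sublocale SL2Z_subgroup \<subseteq> digit_action "unimodular_cosets H" step
  by unfold_locales (use finite_unimodular_cosets step_bij step_transitive in auto)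

context SL2Z_subgroup
begin

text \<open>The integer part may be zero or negative, so it enters through the starting coset; the
  later digits then move that coset.\<close>

lemma approximant_in_cusp_iff:
  assumes \<kappa>: "\<kappa> \<in> cusps H" and x: "x - of_int \<lfloor>x\<rfloor> \<in> irr_unit"
  shows "Some (cf_approximant x n) \<in> \<kappa> \<longleftrightarrow>
    state n (x - of_int \<lfloor>x\<rfloor>) (mat_coset H (digit_mat \<lfloor>x\<rfloor>)) \<in> cusp_cosets H \<kappa>"
proof -
  define w where "w = digits n (x - of_int \<lfloor>x\<rfloor>)"
  define A where "A = foldl (\<lambda>A d. A ** digit_mat (int d)) (digit_mat \<lfloor>x\<rfloor>) w"
  have w: "\<forall>d\<in>set w. 0 < d" using digits_in_words[OF x] by (simp add: w_def)
  have "SL2Z_act A None = Some (cf_approximant x n)"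
    using cf_value_eq_first_column(1,3)[OF w, of "\<lfloor>x\<rfloor>"] cf_digit_eq_digits[OF x, of n]
    by (simp add: cf_approximant_def A_def w_def del: upt_Suc)
  moreover have "\<bar>det A\<bar> = 1"
  proof -
    have "\<bar>det (foldl (\<lambda>A d. A ** digit_mat (int d)) B w)\<bar> = \<bar>det B\<bar>" for B
      by (induction w arbitrary: B) (simp_all add: abs_det_mult_digit_mat)
    then show ?thesis by (simp add: A_def det_digit_mat)
  qed
  ultimately have "Some (cf_approximant x n) \<in> \<kappa> \<longleftrightarrow> mat_coset H A \<in> cusp_cosets H \<kappa>"
    using mat_coset_in_cusp_cosets_iff[OF \<kappa>] by metis
  then show ?thesis by (simp add: state_def foldl_step_mat_coset A_def w_def)
qed

end

theorem theorem1:
  fixes H :: "(int^2^2) set" and \<kappa> :: "rat option set"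
  assumes "subgroup H SL2Z"
    and "finite (rcosets\<^bsub>SL2Z\<^esub> H)"
    and "\<kappa> \<in> cusps H"
  shows "AE x in lebesgue.
           (\<lambda>N. real (card {n. n \<le> N \<and> Some (cf_approximant x n) \<in> \<kappa>}) / real N)
             \<longlonglongrightarrow> real (cusp_width H \<kappa>) / real (group_index PSL2Z (PSL_image H))"
proof (rule AE_completion)
  interpret SL2Z_subgroup H by (rule SL2Z_subgroup.intro) (rule assms)+
  let ?G = "cusp_cosets H \<kappa>" and ?S = "unimodular_cosets H"
  let ?\<sigma> = "\<lambda>m. mat_coset H (digit_mat m)"
  let ?P = "\<lambda>m y. y \<in> irr_unit \<longrightarrow>
    (\<lambda>N. real (card {n. n \<le> N \<and> state n y (?\<sigma> m) \<in> ?G}) / real N)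
      \<longlonglongrightarrow> real (card ?G) / real (card ?S)"
  have "AE y in lborel. ?P m y" for m
    by (rule visit_frequency_set) (auto simp: unimodular_cosets_def cusp_cosets_def det_digit_mat)
  then have "AE x in lborel. ?P m (x - of_int m)" for m
    by (rule AE_lborel_translate)
  \<comment> \<open>One null set for the countably many integer parts, before \<open>m\<close> is
    specialised to the floor of \<open>x\<close>.\<close>
  then have "AE x in lborel. \<forall>m. ?P m (x - of_int m)"
    by (simp add: AE_all_countable)
  moreover have "AE x in lborel. x \<notin> (\<rat> :: real set)"
    by (intro AE_not_in countable_imp_null_set_lborel countable_rat)
  ultimately show "AE x in lborel.
           (\<lambda>N. real (card {n. n \<le> N \<and> Some (cf_approximant x n) \<in> \<kappa>}) / real N)
             \<longlonglongrightarrow> real (cusp_width H \<kappa>) / real (group_index PSL2Z (PSL_image H))"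
  proof eventually_elim
    case (elim x)
    have "x - of_int \<lfloor>x\<rfloor> \<notin> \<rat>"
      using elim(2) Rats_add[of "x - of_int \<lfloor>x\<rfloor>" "of_int \<lfloor>x\<rfloor>"] by auto
    moreover from this have "x - of_int \<lfloor>x\<rfloor> \<noteq> 0" by (metis Rats_0)
    then have "0 < x - of_int \<lfloor>x\<rfloor>" "x - of_int \<lfloor>x\<rfloor> < 1" by linarith+
    ultimately have x: "x - of_int \<lfloor>x\<rfloor> \<in> irr_unit" by (simp add: irr_unit_def)
    have "?P \<lfloor>x\<rfloor> (x - of_int \<lfloor>x\<rfloor>)" using elim(1) by blast
    \<comment> \<open>The factors 2 in the two coset counts cancel.\<close>
    with x show ?case
      by (simp add: approximant_in_cusp_iff[OF assms(3) x] card_cusp_cosets[OF assms(3)]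
          card_unimodular_cosets)
  qed
qed

end
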